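(* Let $\mathfrak{A}$ be a unital C*-algebra, $\mathfrak{H}$ a Hilbert $\mathfrak{A}$-module, and $\omega:=(\omega_n)_{n\in\mathbb{N}^*}$ a weight of $\mathfrak{A}$. 1. Let $(\mathfrak{H}_n)_{n\in\mathbb{N}^*},(\mathfrak{K}_n)_{n\in\mathbb{N}^*}\in\mathfrak{Comp}(\mathfrak{H})^{\mathbb{N}^*}$. If $((\mathfrak{H}_n,\omega_n))_{n\in\mathbb{N}^*}$ is a *-fusion frame of $\mathfrak{H}$ of lower bound $A\in\mathfrak{A}$, and $$\mathfrak{d}_{\mathfrak{q}(\omega)}\left((\mathfrak{H}_n)_{n\in\mathbb{N}^*},(\mathfrak{K}_n)_{n\in\mathbb{N}^*}\right)<\|A^{-1}\|_{\mathfrak{A}}^{-1},$$ then $((\mathfrak{K}_n,\omega_n))_{n\in\mathbb{N}^*}$ is a *-fusion frame of $\mathfrak{H}$. 2. $\mathfrak{Comp}_\omega(\mathfrak{H})^{\mathbb{N}^*}$ is an open set of the topological space $\left(\mathfrak{Comp}(\mathfrak{H})^{\mathbb{N}^*},T_{\mathfrak{q}(\omega)}\right)$.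
   Context: $\mathbb{N}^*=\{1,2,3,\dots\}$. Hilbert $\mathfrak{A}$-modules are left modules with $\mathfrak{A}$-valued inner product $\langle\cdot,\cdot\rangle$ that is $\mathfrak{A}$-linear in the first variable; $|x|:=\langle x,x\rangle^{1/2}\in\mathfrak{A}$ and $\|x\|_{\mathfrak{H}}:=\||x|\|_{\mathfrak{A}}$. For $a,b\in\mathfrak{A}$, $a\preccurlyeq b$ means that $b-a$ is positive. An element of $\mathfrak{A}$ is strictly positive if every nonzero positive linear form takes a value $>0$ on it; since $\mathfrak{A}$ is unital this is equivalent to being positive and invertible. A closed submodule $\mathfrak{K}$ of $\mathfrak{H}$ is orthogonally complemented if $\mathfrak{H}=\mathfrak{K}\oplus\mathfrak{K}^\perp$, where $\mathfrak{K}^\perp=\{u\in\mathfrak{H}:\langle u,x\rangle=0\ \forall x\in\mathfrak{K}\}$; $P_{\mathfrak{K}}$ denotes the corresponding orthogonal projection of $\mathfrak{H}$ onto $\mathfrak{K}$. $\mathfrak{Comp}(\mathfrak{H})$ is the set of all orthogonally complemented submodules of $\mathfrak{H}$, and $\mathfrak{Comp}(\mathfrak{H})^{\mathbb{N}^*}$ the set of sequences in it. A weight of $\mathfrak{A}$ is a sequence $(\omega_n)_{n\in\mathbb{N}^*}$ of central and strictly positive elements of $\mathfrak{A}$. Given $(\mathfrak{H}_n)_{n\in\mathbb{N}^*}\in\mathfrak{Comp}(\mathfrak{H})^{\mathbb{N}^*}$ and a weight $(\omega_n)_{n\in\mathbb{N}^*}$, the sequence $((\mathfrak{H}_n,\omega_n))_{n\in\mathbb{N}^*}$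 is a *-fusion frame of $\mathfrak{H}$ if for each $x\in\mathfrak{H}$ the series $\sum\omega_n^2|P_{\mathfrak{H}_n}(x)|^2$ converges in the norm of $\mathfrak{A}$ and there exist two strictly positive elements $A,B$ of $\mathfrak{A}$ such that $|Ax|^2\preccurlyeq\sum_{n=1}^{+\infty}\omega_n^2|P_{\mathfrak{H}_n}(x)|^2\preccurlyeq|Bx|^2$ for all $x\in\mathfrak{H}$; such $A$ and $B$ are called respectively a lower and an upper bound. $\mathfrak{Comp}_\omega(\mathfrak{H})^{\mathbb{N}^*}$ denotes the set of all $(\mathfrak{K}_n)_{n\in\mathbb{N}^*}\in\mathfrak{Comp}(\mathfrak{H})^{\mathbb{N}^*}$ such that $((\mathfrak{K}_n,\omega_n))_{n\in\mathbb{N}^*}$ is a *-fusion frame of $\mathfrak{H}$. For $U,V\in\mathfrak{Comp}(\mathfrak{H})$, $\mathfrak{d}(U,V):=\|P_U-P_V\|$ (operator norm). For a sequence $w=(w_n)_{n\in\mathbb{N}^*}$ of strictly positive real numbers, $\mathfrak{d}_w:(\mathfrak{Comp}(\mathfrak{H})^{\mathbb{N}^*})^2\to[0,+\infty]$ is defined by $\mathfrak{d}_w((U_n),(V_n)):=\sqrt{\sum_{n=1}^{+\infty}w_n\mathfrak{d}(U_n,V_n)^2}$. $T_w$ is the topology on $\mathfrak{Comp}(\mathfrak{H})^{\mathbb{N}^*}$ whose open sets are the unions of arbitrary families of open balls $\{(V_n):\mathfrak{d}_w((U_n),(V_n))<r\}$, with $(U_n)\in\mathfrak{Comp}(\mathfrak{H})^{\mathbb{N}^*}$,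 $r\ge0$ real. For a weight $\omega$, $\mathfrak{q}(\omega):=(\|\omega_n\|_{\mathfrak{A}}^2)_{n\in\mathbb{N}^*}$. *)

theory Defs
  imports "HOL-Analysis.Analysis" "HOL-Library.Complex_Order"
begin

text \<open>
  Sequences indexed by \<open>{1, 2, 3, \<dots>}\<close> are functions on \<^typ>\<open>nat\<close>; the value at \<open>n\<close> is the
  term of index \<open>n + 1\<close>.
\<close>

section \<open>Unital C*-algebras\<close>

text \<open>
  The norm, the real scalar multiplication and completeness come from the library classes;
  \<^class>\<open>real_normed_algebra_1\<close> includes \<open>norm 1 = 1\<close>, so the algebra is not zero (in the zero
  algebra \<open>\<parallel>\<omega>\<^sub>n\<parallel>\<^sup>2\<close> is not strictly positive).
\<close>

class unital_cstar_algebra = real_normed_algebra_1 + banach +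
  fixes cscale :: "complex \<Rightarrow> 'a \<Rightarrow> 'a"
    and star :: "'a \<Rightarrow> 'a"
  assumes cscale_add_right: "cscale c (a + b) = cscale c a + cscale c b"
    and cscale_add_left: "cscale (c + d) a = cscale c a + cscale d a"
    and cscale_cscale: "cscale c (cscale d a) = cscale (c * d) a"
    and cscale_of_real: "cscale (complex_of_real r) a = r *\<^sub>R a"
    and cscale_mult_left: "cscale c a * b = cscale c (a * b)"
    and cscale_mult_right: "a * cscale c b = cscale c (a * b)"
    and norm_cscale: "norm (cscale c a) = cmod c * norm a"
    and star_star: "star (star a) = a"
    and star_add: "star (a + b) = star a + star b"
    and star_cscale: "star (cscale c a) = cscale (cnj c) (star a)"
    and star_mult: "star (a * b) = star b * star a"
    and cstar_identity: "norm (star a * a) = (norm a)\<^sup>2"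

definition alg_invertible :: "'a::ring_1 \<Rightarrow> bool" where
  "alg_invertible a \<longleftrightarrow> (\<exists>b. a * b = 1 \<and> b * a = 1)"

definition alg_inverse :: "'a::ring_1 \<Rightarrow> 'a" where
  "alg_inverse a = (THE b. a * b = 1 \<and> b * a = 1)"

definition spectrum :: "'a::unital_cstar_algebra \<Rightarrow> complex set" where
  "spectrum a = {c. \<not> alg_invertible (cscale c 1 - a)}"

definition positive_elem :: "'a::unital_cstar_algebra \<Rightarrow> bool" where
  "positive_elem a \<longleftrightarrow> star a = a \<and> (\<forall>c\<in>spectrum a. 0 \<le> c)"

definition cstar_le :: "'a::unital_cstar_algebra \<Rightarrow> 'a \<Rightarrow> bool"  (infix \<open>\<preceq>\<close> 50) where
  "a \<preceq> b \<longleftrightarrow> positive_elem (b - a)"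

definition cstar_sqrt :: "'a::unital_cstar_algebra \<Rightarrow> 'a" where
  "cstar_sqrt a = (THE b. positive_elem b \<and> b\<^sup>2 = a)"

definition positive_form :: "('a::unital_cstar_algebra \<Rightarrow> complex) \<Rightarrow> bool" where
  "positive_form \<phi> \<longleftrightarrow>
     Vector_Spaces.linear cscale (*) \<phi> \<and> (\<forall>a. positive_elem a \<longrightarrow> 0 \<le> \<phi> a)"

definition strictly_positive :: "'a::unital_cstar_algebra \<Rightarrow> bool" where
  "strictly_positive a \<longleftrightarrow> (\<forall>\<phi>. positive_form \<phi> \<and> \<phi> \<noteq> (\<lambda>_. 0) \<longrightarrow> 0 < \<phi> a)"

definition weight :: "(nat \<Rightarrow> 'a::unital_cstar_algebra) \<Rightarrow> bool" where
  "weight \<omega> \<longleftrightarrow> (\<forall>n. (\<forall>a. \<omega> n * a = a * \<omega> n) \<and> strictly_positive (\<omega> n))"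


section \<open>Hilbert modules\<close>

definition mod_abs :: "('h \<Rightarrow> 'h \<Rightarrow> 'a::unital_cstar_algebra) \<Rightarrow> 'h \<Rightarrow> 'a" where
  "mod_abs ip x = cstar_sqrt (ip x x)"

text \<open>
  The module is a Banach space whose norm is required, in \<open>norm_eq\<close>, to be the one induced by the
  inner product. Its complex scalar multiplication is \<open>c x = (c 1) x\<close>, as always over a unital
  algebra.
\<close>

locale hilbert_module =
  fixes act :: "'a::unital_cstar_algebra \<Rightarrow> 'h::banach \<Rightarrow> 'h"
    and ip :: "'h \<Rightarrow> 'h \<Rightarrow> 'a"
  assumes act_add_right: "act a (x + y) = act a x + act a y"
    and act_add_left: "act (a + b) x = act a x + act b x"
    and act_act: "act a (act b x) = act (a * b) x"
    and act_one: "act 1 x = x"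
    and act_of_real: "act (of_real r) x = r *\<^sub>R x"
    and ip_add_left: "ip (x + y) z = ip x z + ip y z"
    and ip_act_left: "ip (act a x) y = a * ip x y"
    and ip_star: "star (ip x y) = ip y x"
    and ip_positive: "positive_elem (ip x x)"
    and ip_definite: "ip x x = 0 \<Longrightarrow> x = 0"
    and norm_eq: "norm x = norm (mod_abs ip x)"

definition submodule :: "('a \<Rightarrow> 'h \<Rightarrow> 'h) \<Rightarrow> 'h::ab_group_add set \<Rightarrow> bool" where
  "submodule act K \<longleftrightarrow>
     0 \<in> K \<and> (\<forall>x\<in>K. \<forall>y\<in>K. x + y \<in> K) \<and> (\<forall>a. \<forall>x\<in>K. act a x \<in> K)"

definition orth_compl :: "('h \<Rightarrow> 'h \<Rightarrow> 'a::zero) \<Rightarrow> 'h set \<Rightarrow> 'h set" where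
  "orth_compl ip K = {u. \<forall>x\<in>K. ip u x = 0}"

definition complemented_submodules ::
    "('a::zero \<Rightarrow> 'h \<Rightarrow> 'h) \<Rightarrow> ('h \<Rightarrow> 'h \<Rightarrow> 'a) \<Rightarrow> 'h::banach set set" where
  "complemented_submodules act ip =
     {K. submodule act K \<and> closed K \<and> K \<inter> orth_compl ip K = {0} \<and>
         (\<forall>x. \<exists>u\<in>K. \<exists>v\<in>orth_compl ip K. x = u + v)}"

definition orth_proj :: "('h \<Rightarrow> 'h \<Rightarrow> 'a::zero) \<Rightarrow> 'h::ab_group_add set \<Rightarrow> 'h \<Rightarrow> 'h" where
  "orth_proj ip K x = (THE u. u \<in> K \<and> x - u \<in> orth_compl ip K)"

definition complemented_seqs ::
    "('a::zero \<Rightarrow> 'h \<Rightarrow> 'h) \<Rightarrow> ('h \<Rightarrow> 'h \<Rightarrow> 'a) \<Rightarrow> (nat \<Rightarrow> 'h::banach set) set" where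
  "complemented_seqs act ip = {U. \<forall>n. U n \<in> complemented_submodules act ip}"


section \<open>*-fusion frames\<close>

definition frame_bounds ::
    "('a::unital_cstar_algebra \<Rightarrow> 'h \<Rightarrow> 'h) \<Rightarrow> ('h \<Rightarrow> 'h \<Rightarrow> 'a) \<Rightarrow>
     (nat \<Rightarrow> 'h::banach set) \<Rightarrow> (nat \<Rightarrow> 'a) \<Rightarrow> 'a \<Rightarrow> 'a \<Rightarrow> bool" where
  "frame_bounds act ip H \<omega> A B \<longleftrightarrow>
     strictly_positive A \<and> strictly_positive B \<and>
     (\<forall>x. (mod_abs ip (act A x))\<^sup>2 \<preceq> (\<Sum>n. (\<omega> n)\<^sup>2 * (mod_abs ip (orth_proj ip (H n) x))\<^sup>2) \<and>
          (\<Sum>n. (\<omega> n)\<^sup>2 * (mod_abs ip (orth_proj ip (H n) x))\<^sup>2) \<preceq> (mod_abs ip (act B x))\<^sup>2)"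

definition star_fusion_frame ::
    "('a::unital_cstar_algebra \<Rightarrow> 'h \<Rightarrow> 'h) \<Rightarrow> ('h \<Rightarrow> 'h \<Rightarrow> 'a) \<Rightarrow>
     (nat \<Rightarrow> 'h::banach set) \<Rightarrow> (nat \<Rightarrow> 'a) \<Rightarrow> bool" where
  "star_fusion_frame act ip H \<omega> \<longleftrightarrow>
     H \<in> complemented_seqs act ip \<and> weight \<omega> \<and>
     (\<forall>x. summable (\<lambda>n. (\<omega> n)\<^sup>2 * (mod_abs ip (orth_proj ip (H n) x))\<^sup>2)) \<and>
     (\<exists>A B. frame_bounds act ip H \<omega> A B)"

definition frame_lower_bound ::
    "('a::unital_cstar_algebra \<Rightarrow> 'h \<Rightarrow> 'h) \<Rightarrow> ('h \<Rightarrow> 'h \<Rightarrow> 'a) \<Rightarrow>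
     (nat \<Rightarrow> 'h::banach set) \<Rightarrow> (nat \<Rightarrow> 'a) \<Rightarrow> 'a \<Rightarrow> bool" where
  "frame_lower_bound act ip H \<omega> A \<longleftrightarrow> (\<exists>B. frame_bounds act ip H \<omega> A B)"

definition frame_seqs ::
    "('a::unital_cstar_algebra \<Rightarrow> 'h \<Rightarrow> 'h) \<Rightarrow> ('h \<Rightarrow> 'h \<Rightarrow> 'a) \<Rightarrow>
     (nat \<Rightarrow> 'a) \<Rightarrow> (nat \<Rightarrow> 'h::banach set) set" where
  "frame_seqs act ip \<omega> = {K \<in> complemented_seqs act ip. star_fusion_frame act ip K \<omega>}"


section \<open>The topology on sequences of complemented submodules\<close>

definition sub_dist :: "('h \<Rightarrow> 'h \<Rightarrow> 'a::zero) \<Rightarrow> 'h::banach set \<Rightarrow> 'h set \<Rightarrow> real" where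
  "sub_dist ip U V = onorm (\<lambda>x. orth_proj ip U x - orth_proj ip V x)"

definition ennreal_sqrt :: "ennreal \<Rightarrow> ennreal" where
  "ennreal_sqrt t = (if t = \<infinity> then \<infinity> else ennreal (sqrt (enn2real t)))"

definition seq_dist ::
    "('h \<Rightarrow> 'h \<Rightarrow> 'a::zero) \<Rightarrow> (nat \<Rightarrow> real) \<Rightarrow> (nat \<Rightarrow> 'h::banach set) \<Rightarrow> (nat \<Rightarrow> 'h set) \<Rightarrow> ennreal"
  where
  "seq_dist ip w U V = ennreal_sqrt (\<Sum>n. ennreal (w n * (sub_dist ip (U n) (V n))\<^sup>2))"

definition seq_ball ::
    "('a::zero \<Rightarrow> 'h \<Rightarrow> 'h) \<Rightarrow> ('h \<Rightarrow> 'h \<Rightarrow> 'a) \<Rightarrow> (nat \<Rightarrow> real) \<Rightarrow>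
     (nat \<Rightarrow> 'h::banach set) \<Rightarrow> real \<Rightarrow> (nat \<Rightarrow> 'h set) set" where
  "seq_ball act ip w U r = {V \<in> complemented_seqs act ip. seq_dist ip w U V < ennreal r}"

definition seq_topology ::
    "('a::zero \<Rightarrow> 'h \<Rightarrow> 'h) \<Rightarrow> ('h \<Rightarrow> 'h \<Rightarrow> 'a) \<Rightarrow> (nat \<Rightarrow> real) \<Rightarrow>
     (nat \<Rightarrow> 'h::banach set) topology" where
  "seq_topology act ip w =
     topology (\<lambda>S. \<exists>\<B>. \<B> \<subseteq> {seq_ball act ip w U r | U r.
                              U \<in> complemented_seqs act ip \<and> 0 \<le> r} \<and> S = \<Union>\<B>)"

definition weight_norms :: "(nat \<Rightarrow> 'a::unital_cstar_algebra) \<Rightarrow> nat \<Rightarrow> real" where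
  "weight_norms \<omega> n = (norm (\<omega> n))\<^sup>2"

end

(* The order on the algebra is described by norms (for self-adjoint a, a >= 0 iff |t - a| <= t for
   some t >= |a|), so no functional calculus beyond an iterative square root is needed. Strictly
   positive elements are bounded below by a positive scalar, because Hahn-Banach, applied to the
   supremum of the spectrum of the real part, provides enough positive forms.

   For a sequence U put q_U(x) = sum omega_n^2 |P_{U_n} x|^2. With D the distance from H to K, the
   l^2 triangle inequality gives |q_K(x)|^(1/2) >= (|A^-1|^-1 - D) |x|, and a similar upper bound.
   As omega_n is central, q_K(a x) = a q_K(x) a^*, and for such quadratic maps an inequality of
   norms implies the inequality in the algebra; so scalar bounds exist for K. Openness is then the
   first part applied to balls, together with the triangle inequality for the distance. *)

theory Submission
  imports Defs
begin

section \<open>Adjoints\<close>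

text \<open>Since positivity is defined by the spectrum, it is not evident that sums of positive
  elements are positive. The norm description settles this, but one direction of it needs
  \<open>norm h\<close> or \<open>- norm h\<close> to be a spectral value of each self-adjoint
  \<open>h\<close>. This comes from the C*-identity for a + i b with commuting self-adjoint a, b: a
  spectral gap at both ends would give g^2 + c^2 = 1 - d with \<open>norm g = 1\<close> and d > 0,
  whereas such an identity bounds \<open>norm g\<close> by sqrt (1 - d). Strict positivity is stated
  through linear forms only, so even the self-adjointness of such elements has to be proved. The
  square-summable sequences over the module are not made into a normed space; the triangle
  inequality is replaced by |u - v|^2 <= (1 + t) |u|^2 + (1 + 1/t) |v|^2, which holds in the algebra
  term by term. The parameter t is fixed at the end: the strict inequality D < |A^-1|^-1 leaves room
  for a factor 1 + e on D^2.\<close>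

lemma star_zero [simp]: "star 0 = (0::'a::unital_cstar_algebra)"
proof -
  have "star (0::'a) + star 0 = star 0"
    by (metis add_0 star_add)
  then show ?thesis by simp
qed

lemma star_uminus [simp]: "star (- a) = - star (a::'a::unital_cstar_algebra)"
proof -
  have "star a + star (- a) = 0"
    by (metis add.right_inverse star_add star_zero)
  then show ?thesis by (metis add_eq_0_iff)
qed

lemma star_diff: "star (a - b) = star a - star (b::'a::unital_cstar_algebra)"
  by (metis diff_conv_add_uminus star_add star_uminus)

lemma star_one [simp]: "star 1 = (1::'a::unital_cstar_algebra)"
  by (metis mult.right_neutral star_mult star_star)

lemma star_scaleR [simp]: "star (r *\<^sub>R a) = r *\<^sub>R star (a::'a::unital_cstar_algebra)"
  by (metis complex_cnj_complex_of_real cscale_of_real star_cscale)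

lemma star_of_real [simp]: "star (of_real r) = (of_real r :: 'a::unital_cstar_algebra)"
  by (simp add: of_real_def)

lemma norm_star [simp]: "norm (star a) = norm (a::'a::unital_cstar_algebra)"
proof -
  have le: "norm b \<le> norm (star b)" for b :: 'a
  proof (cases "b = 0")
    case False
    have "norm b * norm b \<le> norm (star b) * norm b"
      by (metis cstar_identity norm_mult_ineq power2_eq_square)
    with False show ?thesis by simp
  qed simp
  show ?thesis using le[of a] le[of "star a"] by (simp add: star_star)
qed

lemma bounded_linear_star: "bounded_linear (star :: 'a::unital_cstar_algebra \<Rightarrow> 'a)"
  by (rule bounded_linear_intro[where K=1]) (auto simp: star_add)

lemma norm_square_selfadjoint:
  "star a = a \<Longrightarrow> norm (a * a) = (norm (a::'a::unital_cstar_algebra))\<^sup>2"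
  by (metis cstar_identity)

section \<open>Complex scalars and the C*-identity for a + i b\<close>

lemma cscale_zero_right [simp]: "cscale c 0 = (0::'a::unital_cstar_algebra)"
  by (metis add_cancel_right_right cscale_add_right)

lemma cscale_uminus_right: "cscale c (- a) = - cscale c (a::'a::unital_cstar_algebra)"
  by (metis add.right_inverse cscale_add_right cscale_zero_right minus_unique)

lemma cscale_diff_right: "cscale c (a - b) = cscale c a - cscale c (b::'a::unital_cstar_algebra)"
  by (metis cscale_add_right cscale_uminus_right diff_conv_add_uminus)

lemma cscale_one [simp]: "cscale 1 a = (a::'a::unital_cstar_algebra)"
  by (metis cscale_of_real of_real_1 scaleR_one)

lemma cscale_minus_one [simp]: "cscale (- 1) a = - (a::'a::unital_cstar_algebra)"
  by (metis cscale_of_real of_real_1 of_real_minus scaleR_minus1_left)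

lemma cscale_diff_left: "cscale (c - d) a = cscale c a - cscale d (a::'a::unital_cstar_algebra)"
  by (metis cscale_add_left add_diff_cancel_right' diff_add_cancel)

lemma cscale_of_real_one: "cscale (complex_of_real r) 1 = (of_real r :: 'a::unital_cstar_algebra)"
  by (metis cscale_of_real of_real_def)

text \<open>For z = a + i b the cross terms of \<open>star z * z\<close> form i (a b - b a), which
  vanishes.\<close>

lemma norm_combination_selfadjoint:
  fixes a b :: "'a::unital_cstar_algebra"
  assumes "star a = a" "star b = b" "a * b = b * a"
  shows "(norm (a + cscale \<i> b))\<^sup>2 = norm (a * a + b * b)"
proof -
  have "star (a + cscale \<i> b) = a - cscale \<i> b"
    using assms by (metis add_uminus_conv_diff complex_cnj_i cscale_cscale cscale_minus_one
        mult_minus1 star_add star_cscale)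
  moreover have "(a - cscale \<i> b) * (a + cscale \<i> b) =
      a * a + (cscale \<i> (a * b) - cscale \<i> (b * a)) - cscale (\<i> * \<i>) (b * b)"
    by (simp add: algebra_simps cscale_mult_left cscale_mult_right cscale_diff_right cscale_cscale)
  ultimately have "star (a + cscale \<i> b) * (a + cscale \<i> b) = a * a + b * b"
    using assms(3) by simp
  then show ?thesis by (metis cstar_identity)
qed

section \<open>Square roots by iteration\<close>

text \<open>Writing sqrt (1 - x) = 1 - w gives the fixed-point equation w = (x + w^2) / 2, iterated
  from 0. As \<open>norm x = 1\<close> is allowed, the map need not be a contraction; the majorant
  supplies convergence. The iterates are real polynomials in x, so commutation and self-adjointness
  pass to the limit.\<close>

lemma sqrt_one_minus:
  fixes x :: "'a::unital_cstar_algebra"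
  assumes x: "norm x \<le> 1"
  obtains w where "norm w \<le> 1" "(1 - w) * (1 - w) = 1 - x"
    "\<And>y. y * x = x * y \<Longrightarrow> y * w = w * y" "star x = x \<Longrightarrow> star w = w"
proof -
  \<comment> \<open>\<open>r\<close> is the iteration for \<open>x = 1\<close> and majorises all the others.\<close>
  define w where "w = rec_nat (0::'a) (\<lambda>_ u. (1/2) *\<^sub>R (x + u * u))"
  define r where "r = rec_nat (0::real) (\<lambda>_ u. (1 + u * u) / 2)"
  have w0: "w 0 = 0" and wS: "w (Suc n) = (1/2) *\<^sub>R (x + w n * w n)" for n
    by (simp_all add: w_def)
  have r0: "r 0 = 0" and rS: "r (Suc n) = (1 + r n * r n) / 2" for n
    by (simp_all add: r_def)
  have rb: "0 \<le> r n \<and> r n \<le> 1" for n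
  proof (induction n)
    case (Suc n)
    then have "r n * r n \<le> 1" by (simp add: mult_le_one)
    then show ?case using Suc by (simp add: rS)
  qed (simp add: r0)
  have wr: "norm (w n) \<le> r n" for n
  proof (induction n)
    case (Suc n)
    have "norm (w n * w n) \<le> r n * r n"
      by (meson Suc mult_mono norm_ge_zero norm_mult_ineq order_trans rb)
    then have "norm (x + w n * w n) \<le> 1 + r n * r n"
      using x norm_triangle_ineq[of x "w n * w n"] by linarith
    then show ?case by (simp add: wS rS)
  qed (simp add: w0 r0)
  \<comment> \<open>The splitting v^2 - u^2 = v (v - u) + (v - u) u needs no commutation, and the
    increments of \<open>r\<close> satisfy it with equality, so the norm estimate carries over term
    by term.\<close>
  have step: "norm (w (Suc n) - w n) \<le> r (Suc n) - r n" for n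
  proof (induction n)
    case (Suc n)
    have "(1/2) *\<^sub>R (x + v * v) - (1/2) *\<^sub>R (x + u * u) = (1/2) *\<^sub>R (v * (v - u) + (v - u) * u)"
      for u v :: 'a
      by (simp add: algebra_simps flip: scaleR_right_diff_distrib)
    then have "w (Suc (Suc n)) - w (Suc n) =
        (1/2) *\<^sub>R (w (Suc n) * (w (Suc n) - w n) + (w (Suc n) - w n) * w n)"
      using wS by metis
    then have "norm (w (Suc (Suc n)) - w (Suc n)) =
        norm (w (Suc n) * (w (Suc n) - w n) + (w (Suc n) - w n) * w n) / 2"
      by simp
    also have "\<dots> \<le> (r (Suc n) * (r (Suc n) - r n) + (r (Suc n) - r n) * r n) / 2"
    proof -
      have "norm (w (Suc n) * (w (Suc n) - w n)) \<le> r (Suc n) * (r (Suc n) - r n)"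
        by (rule order_trans[OF norm_mult_ineq mult_mono]) (use Suc wr rb in auto)
      moreover have "norm ((w (Suc n) - w n) * w n) \<le> (r (Suc n) - r n) * r n"
        by (rule order_trans[OF norm_mult_ineq mult_mono])
           (use Suc wr rb order_trans[OF norm_ge_zero Suc] in auto)
      ultimately show ?thesis
        using norm_triangle_ineq[of "w (Suc n) * (w (Suc n) - w n)" "(w (Suc n) - w n) * w n"]
        by (simp add: divide_right_mono)
    qed
    also have "\<dots> = r (Suc (Suc n)) - r (Suc n)"
    proof -
      have "(v * (v - u) + (v - u) * u) / 2 = (1 + v * v) / 2 - (1 + u * u) / 2" for u v :: real
        by (simp add: field_simps)
      then show ?thesis using rS by metis
    qed
    finally show ?case .
  qed (simp add: w0 r0 wS rS x)
  have far: "norm (w (n + k) - w n) \<le> r (n + k) - r n" for n k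
  proof (induction k)
    case (Suc k)
    have "norm (w (n + Suc k) - w n) \<le> norm (w (Suc (n + k)) - w (n + k)) + norm (w (n + k) - w n)"
      using norm_triangle_ineq[of "w (Suc (n + k)) - w (n + k)" "w (n + k) - w n"] by simp
    then show ?case using Suc step[of "n + k"] by simp
  qed simp
  have "incseq r"
    by (rule incseq_SucI) (smt (verit) norm_ge_zero step)
  then have "convergent r"
    using rb by (intro Bseq_mono_convergent BseqI'[where K=1]) (auto simp: incseq_def)
  then have "Cauchy r" by (rule convergent_Cauchy)
  have "Cauchy w"
  proof (rule CauchyI)
    fix e :: real assume "0 < e"
    with \<open>Cauchy r\<close> obtain M where M: "\<forall>m\<ge>M. \<forall>n\<ge>M. norm (r m - r n) < e"
      using CauchyD by blast
    have "norm (w m - w n) < e" if "m \<ge> M" "n \<ge> M" for m n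
      using that
    proof (induction m n rule: linorder_wlog)
      case (le m n)
      then have "norm (w n - w m) \<le> r n - r m" using far[of m "n - m"] by simp
      also have "\<dots> < e" using M le by (metis abs_ge_self order_le_less_trans real_norm_def)
      finally show ?case by (simp add: norm_minus_commute)
    qed (simp add: norm_minus_commute)
    then show "\<exists>M. \<forall>m\<ge>M. \<forall>n\<ge>M. norm (w m - w n) < e" by blast
  qed
  then obtain l where l: "w \<longlonglongrightarrow> l"
    using Cauchy_convergent convergent_def by blast
  have "(\<lambda>n. w (Suc n)) \<longlonglongrightarrow> (1/2) *\<^sub>R (x + l * l)"
    unfolding wS by (intro tendsto_intros l)
  then have fix_l: "l = (1/2) *\<^sub>R (x + l * l)"
    using l LIMSEQ_Suc LIMSEQ_unique by blast
  show thesis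
  proof
    show "norm l \<le> 1"
      by (rule LIMSEQ_le_const2[OF tendsto_norm[OF l]]) (meson order_trans rb wr)
    have "l + l = x + l * l"
      using fix_l by (metis scaleR_half_double scaleR_right_distrib)
    then show "(1 - l) * (1 - l) = 1 - x"
      by (simp add: algebra_simps)
  next
    fix y assume y: "y * x = x * y"
    have "y * w n = w n * y" for n
    proof (induction n)
      case (Suc n)
      then have "y * (w n * w n) = w n * w n * y" by (metis mult.assoc)
      then show ?case using y by (simp add: wS algebra_simps)
    qed (simp add: w0)
    then have "(\<lambda>n. y * w n) \<longlonglongrightarrow> l * y"
      by (simp add: tendsto_mult_right[OF l] tendsto_mult_left[OF l] tendsto_mult l)
    moreover have "(\<lambda>n. y * w n) \<longlonglongrightarrow> y * l" by (intro tendsto_intros l)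
    ultimately show "y * l = l * y" using LIMSEQ_unique by blast
  next
    assume "star x = x"
    have "star (w n) = w n" for n
      by (induction n) (simp_all add: w0 wS star_add star_mult \<open>star x = x\<close>)
    then show "star l = l"
      using bounded_linear.tendsto[OF bounded_linear_star l] l LIMSEQ_unique by fastforce
  qed
qed

section \<open>Invertibility and the spectrum\<close>

lemma alg_invertible_mult:
  assumes "alg_invertible (a::'a::ring_1)" "alg_invertible b"
  shows "alg_invertible (a * b)"
proof -
  obtain u v where uv: "a * u = 1" "u * a = 1" "b * v = 1" "v * b = 1"
    using assms alg_invertible_def by blast
  have "a * b * (v * u) = a * (b * v) * u" "v * u * (a * b) = v * (u * a) * b"
    by (simp_all add: mult.assoc)
  then show ?thesis unfolding alg_invertible_def using uv by (metis mult_1_right)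
qed

lemma alg_invertible_uminus_iff [simp]: "alg_invertible (- a) \<longleftrightarrow> alg_invertible (a::'a::ring_1)"
proof -
  have "alg_invertible (- b)" if "alg_invertible b" for b :: 'a
    using that unfolding alg_invertible_def by (metis minus_mult_minus)
  from this[of a] this[of "- a"] show ?thesis by auto
qed

lemma alg_invertible_square_iff: "alg_invertible (a * a) \<longleftrightarrow> alg_invertible (a::'a::ring_1)"
proof
  assume "alg_invertible (a * a)"
  then obtain u where u: "a * a * u = 1" "u * (a * a) = 1"
    using alg_invertible_def by blast
  \<comment> \<open>The inverse of a^2 commutes with a, which makes \<open>a * u\<close> an inverse
    of a on both sides.\<close>
  then have "u * a = a * u" by (metis mult.assoc mult.right_neutral mult_1)
  then show "alg_invertible a"
    unfolding alg_invertible_def using u by (metis mult.assoc)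
qed (rule alg_invertible_mult)

lemma commute_inverse:
  assumes "(a::'a::ring_1) * u = 1" "u * a = 1" "a * b = b * a"
  shows "u * b = b * u"
  by (metis assms mult.assoc mult.right_neutral mult_1)

lemma selfadjoint_inverse:
  assumes "(a::'a::unital_cstar_algebra) * u = 1" "u * a = 1" "star a = a"
  shows "star u = u"
  by (metis assms mult.assoc mult.right_neutral mult_1 star_mult star_one)

lemma alg_invertible_cscale:
  assumes "c \<noteq> 0" "alg_invertible a"
  shows "alg_invertible (cscale c a)"
proof -
  obtain u where u: "a * u = 1" "u * a = 1" using assms alg_invertible_def by blast
  have "cscale c a * cscale (1 / c) u = 1" "cscale (1 / c) u * cscale c a = 1"
    using u assms(1) by (simp_all add: cscale_mult_left cscale_mult_right cscale_cscale)
  then show ?thesis unfolding alg_invertible_def by blast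
qed

text \<open>The inverse is the Neumann series.\<close>

lemma alg_invertible_one_minus:
  fixes x :: "'a::{real_normed_algebra_1,banach}"
  assumes "norm x < 1"
  shows "alg_invertible (1 - x)"
proof -
  have s: "summable (\<lambda>n. x ^ n)" by (rule complete_algebra_summable_geometric[OF assms])
  have "(\<Sum>n. x ^ Suc n) = (\<Sum>n. x ^ n) - 1"
    using suminf_split_head[OF s] by simp
  moreover have "(\<Sum>n. x ^ Suc n) = x * (\<Sum>n. x ^ n)"
    using suminf_mult[OF s, of x] by simp
  moreover have "(\<Sum>n. x ^ Suc n) = (\<Sum>n. x ^ n) * x"
    using suminf_mult2[OF s, of x] by (simp add: power_commutes)
  ultimately have "(1 - x) * (\<Sum>n. x ^ n) = 1" "(\<Sum>n. x ^ n) * (1 - x) = 1"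
    by (simp_all add: algebra_simps)
  then show ?thesis unfolding alg_invertible_def by blast
qed

text \<open>For \<open>cmod c > norm a\<close> factor c - a = c (1 - a / c); the second factor is
  invertible by the Neumann series.\<close>

lemma spectrum_norm_le:
  assumes "c \<in> spectrum a"
  shows "cmod c \<le> norm a"
proof (rule ccontr)
  assume less: "\<not> cmod c \<le> norm a"
  then have c: "c \<noteq> 0" by auto
  have "norm (cscale (1 / c) a) < 1"
    using less c by (simp add: norm_cscale norm_divide field_simps)
  then have "alg_invertible (cscale c (1 - cscale (1 / c) a))"
    by (intro alg_invertible_cscale alg_invertible_one_minus c)
  then show False
    using assms c by (simp add: spectrum_def cscale_diff_right cscale_cscale)
qed

lemma spectrum_translate: "c + d \<in> spectrum (a + cscale d 1) \<longleftrightarrow> c \<in> spectrum a"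
  by (simp add: spectrum_def cscale_add_left)

lemma spectrum_reflect:
  "complex_of_real s - c \<in> spectrum (of_real s - a) \<longleftrightarrow> c \<in> spectrum a"
proof -
  have "cscale (complex_of_real s - c) 1 - (of_real s - a) = - (cscale c 1 - a)"
    by (simp add: cscale_diff_left cscale_of_real_one)
  then show ?thesis by (simp only: spectrum_def mem_Collect_eq alg_invertible_uminus_iff)
qed

lemma of_real_in_spectrum_iff:
  "complex_of_real r \<in> spectrum a \<longleftrightarrow> \<not> alg_invertible (of_real r - a)"
  by (simp add: spectrum_def cscale_of_real_one)

text \<open>Replacing \<open>h\<close> by \<open>h + \<i>t\<close> with \<open>t\<close> real moves a spectral value \<open>c\<close> to \<open>c + \<i>t\<close>, while
  the squared norm grows by at most \<open>t\<^sup>2\<close>.\<close>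

lemma spectrum_selfadjoint_real:
  fixes h :: "'a::unital_cstar_algebra"
  assumes h: "star h = h" and c: "c \<in> spectrum h"
  shows "Im c = 0"
proof (rule ccontr)
  assume ne: "Im c \<noteq> 0"
  \<comment> \<open>This makes the cross term 2 t Im c equal to (norm h)^2, so the two estimates
    below contradict each other by (Im c)^2.\<close>
  define t where "t = (norm h)\<^sup>2 / (2 * Im c)"
  have "c + \<i> * complex_of_real t \<in> spectrum (h + cscale (\<i> * complex_of_real t) 1)"
    using c by (simp only: spectrum_translate)
  then have "cmod (c + \<i> * complex_of_real t) \<le> norm (h + cscale \<i> (of_real t))"
    using spectrum_norm_le by (metis cscale_cscale cscale_of_real_one)
  then have "(cmod (c + \<i> * complex_of_real t))\<^sup>2 \<le> (norm (h + cscale \<i> (of_real t)))\<^sup>2"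
    by (simp add: power_mono)
  also have "\<dots> = norm (h * h + of_real t * of_real t)"
    by (rule norm_combination_selfadjoint[OF h]) (simp_all add: of_real_def)
  also have "\<dots> \<le> (norm h)\<^sup>2 + t\<^sup>2"
    using norm_triangle_ineq[of "h * h" "of_real t * of_real t"]
    by (simp add: norm_square_selfadjoint[OF h] power2_eq_square flip: of_real_mult)
  finally have "(Im c + t)\<^sup>2 \<le> (norm h)\<^sup>2 + t\<^sup>2"
    by (simp add: cmod_power2) (smt (verit) zero_le_power2)
  moreover have "(Im c + t)\<^sup>2 = (Im c)\<^sup>2 + (norm h)\<^sup>2 + t\<^sup>2"
    using ne by (simp add: t_def field_simps power2_eq_square)
  ultimately show False using ne by simp
qed

text \<open>Both u + i v and u - i v have norm sqrt T by the C*-identity, and u is half their sum.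
  This does the work of monotonicity of the norm before any positivity is available.\<close>

lemma norm_le_sum_squares:
  fixes u v :: "'a::unital_cstar_algebra"
  assumes "star u = u" "star v = v" "u * v = v * u" "u * u + v * v = of_real T" "0 \<le> T"
  shows "(norm u)\<^sup>2 \<le> T"
proof -
  have "norm (u + cscale \<i> v) = sqrt T"
    using norm_combination_selfadjoint[OF assms(1-3)] assms(4,5)
    by (metis abs_of_nonneg norm_ge_zero norm_of_real real_sqrt_unique)
  moreover have "norm (u + cscale \<i> (- v)) = sqrt T"
    using norm_combination_selfadjoint[of u "- v"] assms
    by (metis abs_of_nonneg minus_mult_minus minus_mult_commute mult_minus_left mult_minus_right
        norm_ge_zero norm_of_real real_sqrt_unique star_uminus)
  moreover have "2 *\<^sub>R u = (u + cscale \<i> v) + (u + cscale \<i> (- v))"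
    by (simp add: cscale_uminus_right scaleR_2)
  ultimately have "norm (2 *\<^sub>R u) \<le> sqrt T + sqrt T"
    by (metis norm_triangle_ineq)
  then have "norm u \<le> sqrt T" by simp
  then show ?thesis using assms(5) by (metis norm_ge_zero power_mono real_sqrt_pow2)
qed

text \<open>Otherwise v = sqrt (1 - g^2) has an inverse u. For small d > 0 there is s with s^2 = 1 -
  d u^2, and (v s)^2 = v^2 - d. Then g^2 + (v s)^2 = 1 - d forces the norm of g below 1.\<close>

lemma unit_selfadjoint_not_invertible:
  fixes g :: "'a::unital_cstar_algebra"
  assumes g: "star g = g" and n: "norm g = 1"
  shows "\<not> (alg_invertible (1 - g) \<and> alg_invertible (1 + g))"
proof
  assume "alg_invertible (1 - g) \<and> alg_invertible (1 + g)"
  then have "alg_invertible ((1 - g) * (1 + g))" by (simp add: alg_invertible_mult)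
  then have inv: "alg_invertible (1 - g * g)" by (simp add: algebra_simps)
  have "norm (g * g) \<le> 1" using norm_square_selfadjoint[OF g] n by simp
  then obtain w where w: "(1 - w) * (1 - w) = 1 - g * g"
      "\<And>y. y * (g * g) = g * g * y \<Longrightarrow> y * w = w * y" "star (g * g) = g * g \<Longrightarrow> star w = w"
    using sqrt_one_minus by metis
  define v where "v = 1 - w"
  have vv: "v * v = 1 - g * g" using w(1) v_def by simp
  have sv: "star v = v" using w(3) g by (simp add: v_def star_diff star_mult)
  have gv: "g * v = v * g" using w(2)[of g] by (simp add: v_def algebra_simps)
  have "alg_invertible v" using inv vv alg_invertible_square_iff by metis
  then obtain u where u: "v * u = 1" "u * v = 1" unfolding alg_invertible_def by blast
  have su: "star u = u" by (rule selfadjoint_inverse[OF u sv])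
  have gu: "u * g = g * u" by (rule commute_inverse[OF u gv[symmetric]])
  \<comment> \<open>Small enough for 1 - d u^2 to have a square root; the bound 1/2 keeps 1 - d
    nonnegative.\<close>
  define d where "d = min (1/2) (1 / norm (u * u))"
  have "u * u \<noteq> 0" using u by (metis mult.assoc mult_zero_left mult_zero_right mult_1 zero_neq_one)
  then have d: "0 < d" "d \<le> 1/2" "norm (d *\<^sub>R (u * u)) \<le> 1"
    by (auto simp: d_def field_simps min_def)
  obtain z where z: "(1 - z) * (1 - z) = 1 - d *\<^sub>R (u * u)"
      "\<And>y. y * (d *\<^sub>R (u * u)) = d *\<^sub>R (u * u) * y \<Longrightarrow> y * z = z * y"
      "star (d *\<^sub>R (u * u)) = d *\<^sub>R (u * u) \<Longrightarrow> star z = z"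
    using sqrt_one_minus[OF d(3)] by metis
  have sz: "star z = z" using z(3) su by (simp add: star_mult)
  have com: "y * z = z * y" if "y * u = u * y" for y
  proof -
    have "y * (u * u) = u * u * y" using that by (metis mult.assoc)
    then show ?thesis using z(2)[of y] by simp
  qed
  define s where "s = 1 - z"
  have ss: "s * s = 1 - d *\<^sub>R (u * u)" and sts: "star s = s"
    using z(1) sz by (simp_all add: s_def star_diff)
  have gs: "g * s = s * g" using com[of g] gu by (simp add: s_def algebra_simps)
  have vs: "v * s = s * v" using com[of v] u by (simp add: s_def algebra_simps)
  have "(v * s) * (v * s) = v * v * (s * s)" using vs by (metis mult.assoc)
  also have "\<dots> = v * v - d *\<^sub>R (v * v * (u * u))" by (simp add: ss algebra_simps)
  also have "v * v * (u * u) = 1" using u by (metis mult.assoc mult.right_neutral)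
  finally have "g * g + (v * s) * (v * s) = of_real (1 - d)"
    by (simp add: vv of_real_def scaleR_left_diff_distrib)
  moreover have "star (v * s) = v * s" using vs sv sts by (simp add: star_mult)
  moreover have "g * (v * s) = v * s * g" using gv gs by (metis mult.assoc)
  ultimately have "(norm g)\<^sup>2 \<le> 1 - d"
    using norm_le_sum_squares[OF g] d(2) by force
  then show False using n d(1) by simp
qed

text \<open>Stands in for the spectral radius formula: if both values were missing, h divided by its
  norm would be a unit vector g with 1 - g and 1 + g invertible.\<close>

lemma norm_in_spectrum:
  fixes h :: "'a::unital_cstar_algebra"
  assumes h: "star h = h"
  shows "complex_of_real (norm h) \<in> spectrum h \<or> complex_of_real (- norm h) \<in> spectrum h"
proof (rule ccontr)
  assume c: "\<not> ?thesis"
  let ?n = "norm h"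
  have i1: "alg_invertible (of_real ?n - h)" and i2: "alg_invertible (of_real (- ?n) - h)"
    using c by (simp_all only: of_real_in_spectrum_iff de_Morgan_disj not_not)
  have "h \<noteq> 0"
    using i1 by (auto simp: alg_invertible_def)
  define g where "g = (1 / ?n) *\<^sub>R h"
  have gh: "?n *\<^sub>R g = h" using \<open>h \<noteq> 0\<close> by (simp add: g_def)
  have e1: "1 - g = cscale (complex_of_real (1 / ?n)) (of_real ?n - h)"
    using \<open>h \<noteq> 0\<close> by (simp only: cscale_of_real) (simp add: g_def of_real_def scaleR_right_diff_distrib)
  have e2: "1 + g = cscale (complex_of_real (- 1 / ?n)) (of_real (- ?n) - h)"
    using \<open>h \<noteq> 0\<close> by (simp only: cscale_of_real) (simp add: g_def of_real_def scaleR_right_diff_distrib)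
  have "alg_invertible (1 - g)" "alg_invertible (1 + g)"
    unfolding e1 e2 using \<open>h \<noteq> 0\<close> i1 i2 by (auto intro!: alg_invertible_cscale)
  moreover have "star g = g" "norm g = 1" using h \<open>h \<noteq> 0\<close> by (simp_all add: g_def)
  ultimately show False using unit_selfadjoint_not_invertible by blast
qed

section \<open>The positive cone\<close>

lemma positive_selfadjoint: "positive_elem a \<Longrightarrow> star a = a"
  by (simp add: positive_elem_def)

text \<open>The spectrum of a is real and lies in the disc of radius t about t.\<close>

lemma positive_normI:
  fixes a :: "'a::unital_cstar_algebra"
  assumes a: "star a = a" and n: "norm (of_real t - a) \<le> t"
  shows "positive_elem a"
proof -
  have "0 \<le> c" if c: "c \<in> spectrum a" for c
  proof -
    have im: "Im c = 0" by (rule spectrum_selfadjoint_real[OF a c])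
    have "cmod (complex_of_real t - c) \<le> t"
      using spectrum_norm_le[of "complex_of_real t - c" "of_real t - a"] c n
      by (simp add: spectrum_reflect)
    moreover have "complex_of_real t - c = complex_of_real (t - Re c)"
      using im by (simp add: complex_eq_iff)
    ultimately have "\<bar>t - Re c\<bar> \<le> t" by (simp only: norm_of_real)
    then show ?thesis using im by (simp add: less_eq_complex_def)
  qed
  then show ?thesis using a by (simp add: positive_elem_def)
qed

text \<open>The spectrum of t - a lies in [0, t], and up to sign the norm of this element is a
  spectral value.\<close>

lemma positive_normD:
  fixes a :: "'a::unital_cstar_algebra"
  assumes a: "positive_elem a" and t: "norm a \<le> t"
  shows "norm (of_real t - a) \<le> t"
proof -
  let ?b = "of_real t - a"
  have sb: "star ?b = ?b" using a by (simp add: positive_elem_def star_diff)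
  have val: "t - s \<ge> 0 \<and> t - s \<le> norm a" if s: "complex_of_real s \<in> spectrum ?b" for s
  proof -
    have c: "complex_of_real (t - s) \<in> spectrum a"
      using s spectrum_reflect[of t "complex_of_real (t - s)" a] by simp
    then have "0 \<le> complex_of_real (t - s)" using a unfolding positive_elem_def by blast
    moreover have "cmod (complex_of_real (t - s)) \<le> norm a" by (rule spectrum_norm_le[OF c])
    ultimately show ?thesis by (simp add: less_eq_complex_def del: of_real_diff)
  qed
  from norm_in_spectrum[OF sb] val[of "norm ?b"] val[of "- norm ?b"] t
  show ?thesis by fastforce
qed

section \<open>Closure properties of the cone and monotonicity of the norm\<close>

lemma positive_zero [simp]: "positive_elem 0"
  by (rule positive_normI[where t=0]) auto

text \<open>The spectrum of a sum of noncommuting elements is not accessible from those of the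
  summands, but the norm bounds simply add.\<close>

lemma positive_add:
  assumes "positive_elem a" "positive_elem b"
  shows "positive_elem (a + b)"
proof (rule positive_normI[where t = "norm a + norm b"])
  show "star (a + b) = a + b" using assms by (simp add: star_add positive_selfadjoint)
  have "of_real (norm a + norm b) - (a + b) = (of_real (norm a) - a) + (of_real (norm b) - b)"
    by simp
  then have "norm (of_real (norm a + norm b) - (a + b))
      \<le> norm (of_real (norm a) - a) + norm (of_real (norm b) - b)"
    by (metis norm_triangle_ineq)
  then show "norm (of_real (norm a + norm b) - (a + b)) \<le> norm a + norm b"
    using assms positive_normD[of a "norm a"] positive_normD[of b "norm b"] by simp
qed

lemma positive_sum: "(\<And>i. i \<in> I \<Longrightarrow> positive_elem (f i)) \<Longrightarrow> positive_elem (sum f I)"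
  by (induction I rule: infinite_finite_induct) (auto intro: positive_add)

lemma positive_scaleR:
  assumes "positive_elem a" "0 \<le> r"
  shows "positive_elem (r *\<^sub>R a)"
proof (rule positive_normI[where t = "r * norm a"])
  show "star (r *\<^sub>R a) = r *\<^sub>R a" using assms by (simp add: positive_selfadjoint)
  have "of_real (r * norm a) - r *\<^sub>R a = r *\<^sub>R (of_real (norm a) - a)"
    by (simp add: of_real_def scaleR_right_diff_distrib)
  then show "norm (of_real (r * norm a) - r *\<^sub>R a) \<le> r * norm a"
    using assms positive_normD[of a "norm a"] by (simp add: mult_left_mono)
qed

lemma positive_of_real: "0 \<le> r \<Longrightarrow> positive_elem (of_real r)"
  by (rule positive_normI[where t=r]) auto

lemma positive_diff_norm:
  fixes a :: "'a::unital_cstar_algebra"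
  assumes "star a = a" "norm a \<le> t"
  shows "positive_elem (of_real t - a)"
  by (rule positive_normI[where t=t]) (use assms in \<open>auto simp: star_diff\<close>)

text \<open>The norm criterion with t = \<open>norm (f x)\<close> is an inequality between
  continuous expressions, hence survives limits.\<close>

lemma positive_limit:
  fixes f :: "'b \<Rightarrow> 'a::unital_cstar_algebra"
  assumes lim: "(f \<longlongrightarrow> a) F" and ev: "eventually (\<lambda>x. positive_elem (f x)) F" and F: "F \<noteq> bot"
  shows "positive_elem a"
proof -
  have "((\<lambda>x. star (f x)) \<longlongrightarrow> star a) F"
    by (rule bounded_linear.tendsto[OF bounded_linear_star lim])
  moreover have "eventually (\<lambda>x. star (f x) = f x) F"
    using ev by eventually_elim (rule positive_selfadjoint)
  ultimately have "(f \<longlongrightarrow> star a) F" by (rule Lim_transform_eventually)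
  then have s: "star a = a" using lim F tendsto_unique by blast
  have "((\<lambda>x. norm (of_real (norm (f x)) - f x)) \<longlongrightarrow> norm (of_real (norm a) - a)) F"
    "((\<lambda>x. norm (f x)) \<longlongrightarrow> norm a) F"
    by (intro tendsto_intros lim)+
  moreover have "eventually (\<lambda>x. norm (of_real (norm (f x)) - f x) \<le> norm (f x)) F"
    using ev by eventually_elim (simp add: positive_normD)
  ultimately have "norm (of_real (norm a) - a) \<le> norm a"
    using tendsto_le[OF F] by blast
  with s show ?thesis by (rule positive_normI)
qed

lemma positive_suminf:
  fixes f :: "nat \<Rightarrow> 'a::unital_cstar_algebra"
  assumes "summable f" "\<And>n. positive_elem (f n)"
  shows "positive_elem (suminf f)"
  by (rule positive_limit[OF summable_LIMSEQ[OF assms(1)]]) (simp_all add: positive_sum assms always_eventually)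

text \<open>After scaling to norm 1, write 1 - g^2 = (1 - w)^2 with w commuting with g. The bound
  for sums of squares gives norm (1 - g^2) <= 1, which is the norm criterion with t = 1.\<close>

lemma positive_square:
  fixes h :: "'a::unital_cstar_algebra"
  assumes h: "star h = h"
  shows "positive_elem (h * h)"
proof (cases "h = 0")
  case False
  define g where "g = (1 / norm h) *\<^sub>R h"
  have g: "star g = g" "norm g = 1" using h False by (simp_all add: g_def)
  have gg: "star (g * g) = g * g" using g by (simp add: star_mult)
  have "norm (g * g) \<le> 1" using norm_square_selfadjoint[OF g(1)] g by simp
  then obtain w where w: "(1 - w) * (1 - w) = 1 - g * g"
      "\<And>y. y * (g * g) = g * g * y \<Longrightarrow> y * w = w * y" "star (g * g) = g * g \<Longrightarrow> star w = w"
    using sqrt_one_minus by metis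
  have "g * (1 - w) = (1 - w) * g" using w(2)[of g] by (simp add: algebra_simps)
  moreover have "(1 - w) * (1 - w) + g * g = of_real 1" by (simp add: w(1))
  ultimately have "(norm (1 - w))\<^sup>2 \<le> 1"
    using w(3)[OF gg] g by (intro norm_le_sum_squares[of "1 - w" g]) (auto simp: star_diff)
  moreover have "(norm (1 - w))\<^sup>2 = norm ((1 - w) * (1 - w))"
    by (rule norm_square_selfadjoint[symmetric]) (simp add: star_diff w(3)[OF gg])
  ultimately have "norm (of_real 1 - g * g) \<le> 1" by (simp add: w(1))
  then have "positive_elem ((norm h)\<^sup>2 *\<^sub>R (g * g))"
    using gg by (intro positive_scaleR positive_normI[where t=1]) auto
  also have "(norm h)\<^sup>2 *\<^sub>R (g * g) = h * h" using False by (simp add: g_def power2_eq_square)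
  finally show ?thesis .
qed simp

lemma positive_eq_zero:
  fixes a :: "'a::unital_cstar_algebra"
  assumes "positive_elem a" "positive_elem (- a)"
  shows "a = 0"
proof -
  have "star a = a" using assms by (simp add: positive_selfadjoint)
  have "c = 0" if "complex_of_real c \<in> spectrum a" for c
  proof -
    have "complex_of_real (- c) \<in> spectrum (- a)"
      using that spectrum_reflect[of 0 "complex_of_real c" a] by simp
    with that assms have "0 \<le> complex_of_real c" "0 \<le> complex_of_real (- c)"
      unfolding positive_elem_def by blast+
    then show ?thesis by (simp add: less_eq_complex_def)
  qed
  then show ?thesis using norm_in_spectrum[OF \<open>star a = a\<close>] by fastforce
qed

text \<open>From a <= b <= norm b the spectrum of a lies in [0, norm b], and the norm of a is
  attained there up to sign.\<close>

lemma norm_mono_positive: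
  fixes a :: "'a::unital_cstar_algebra"
  assumes a: "positive_elem a" and ab: "positive_elem (b - a)"
  shows "norm a \<le> norm b"
proof -
  have "positive_elem b" using positive_add[OF a ab] by simp
  then have "positive_elem (of_real (norm b) - b + (b - a))"
    by (intro positive_add[OF _ ab] positive_diff_norm) (auto simp: positive_selfadjoint)
  then have p: "positive_elem (of_real (norm b) - a)" by simp
  have "c \<le> norm b" if "complex_of_real c \<in> spectrum a" for c
  proof -
    have "complex_of_real (norm b - c) \<in> spectrum (of_real (norm b) - a)"
      using that spectrum_reflect[of "norm b" "complex_of_real c" a] by simp
    then have "0 \<le> complex_of_real (norm b - c)" using p unfolding positive_elem_def by blast
    then show ?thesis by (simp add: less_eq_complex_def)
  qed
  moreover have "0 \<le> c" if "complex_of_real c \<in> spectrum a" for c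
    using that a unfolding positive_elem_def by (fastforce simp: less_eq_complex_def)
  ultimately show ?thesis
    using norm_in_spectrum[OF positive_selfadjoint[OF a]] order_trans[OF _ norm_ge_zero[of b]]
    by fastforce
qed

text \<open>By the norm criterion a = t (1 - x) with t = \<open>norm a\<close> and
  \<open>norm x <= 1\<close>, so the iteration applies to x. That the root commutes with the
  commutant of a is what products and uniqueness rely on.\<close>

lemma positive_sqrt_exists:
  fixes a :: "'a::unital_cstar_algebra"
  assumes a: "positive_elem a"
  obtains b where "positive_elem b" "b * b = a" "\<And>y. y * a = a * y \<Longrightarrow> y * b = b * y"
proof (cases "a = 0")
  case True
  then show ?thesis using that[of 0] by simp
next
  case False
  define t where "t = norm a"
  have t: "t > 0" using False by (simp add: t_def)
  define x where "x = 1 - (1 / t) *\<^sub>R a"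
  have "x = (1 / t) *\<^sub>R (of_real t - a)"
    using t by (simp add: x_def of_real_def scaleR_right_diff_distrib)
  then have "norm x \<le> 1"
    using positive_normD[OF a, of t] t by (simp add: t_def)
  moreover have "star x = x" using a by (simp add: x_def star_diff positive_selfadjoint)
  ultimately obtain w where w: "norm w \<le> 1" "(1 - w) * (1 - w) = 1 - x" "star w = w"
      "\<And>y. y * x = x * y \<Longrightarrow> y * w = w * y"
    using sqrt_one_minus by metis
  show thesis
  proof
    have "positive_elem (1 - w)" using positive_diff_norm[of w 1] w by simp
    then show "positive_elem (sqrt t *\<^sub>R (1 - w))" using t by (simp add: positive_scaleR)
    have "sqrt t *\<^sub>R (1 - w) * sqrt t *\<^sub>R (1 - w) = t *\<^sub>R (1 - x)"
      using t by (simp only: w(2)[symmetric] mult_scaleR_left mult_scaleR_right scaleR_scaleR) simp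
    then show "sqrt t *\<^sub>R (1 - w) * sqrt t *\<^sub>R (1 - w) = a"
      using t by (simp add: x_def)
  next
    fix y assume "y * a = a * y"
    then have "y * w = w * y" by (intro w(4)) (simp add: x_def algebra_simps)
    then show "y * sqrt t *\<^sub>R (1 - w) = sqrt t *\<^sub>R (1 - w) * y" by (simp add: algebra_simps)
  qed
qed

text \<open>The roots u and v commute with whatever commutes with a and b, hence with each other, so
  a b is the square of the self-adjoint element u v.\<close>

lemma positive_mult_commute:
  fixes a b :: "'a::unital_cstar_algebra"
  assumes "positive_elem a" "positive_elem b" "a * b = b * a"
  shows "positive_elem (a * b)"
proof -
  obtain u where u: "positive_elem u" "u * u = a" "\<And>y. y * a = a * y \<Longrightarrow> y * u = u * y"
    by (rule positive_sqrt_exists[OF assms(1)]) blast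
  obtain v where v: "positive_elem v" "v * v = b" "\<And>y. y * b = b * y \<Longrightarrow> y * v = v * y"
    by (rule positive_sqrt_exists[OF assms(2)]) blast
  have vu: "v * u = u * v" using u(3) v(3) assms(3) by metis
  have "u * v * (u * v) = u * (v * u) * v" by (simp add: mult.assoc)
  also have "\<dots> = u * u * (v * v)" by (simp add: vu mult.assoc)
  finally have "u * v * (u * v) = a * b" by (simp only: u(2) v(2))
  moreover have "star (u * v) = u * v"
    by (simp add: star_mult positive_selfadjoint u(1) v(1) vu)
  ultimately show ?thesis using positive_square by metis
qed

text \<open>Two commuting positive roots \<open>b\<close>, \<open>c\<close> satisfy \<open>(b - c) b (b - c) + (b - c) c (b - c) = 0\<close>
  with both terms positive, so \<open>(b - c)\<^sup>3 = 0\<close>.\<close>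

lemma positive_sqrt_unique:
  fixes b c :: "'a::unital_cstar_algebra"
  assumes b: "positive_elem b" and c: "positive_elem c" and eq: "b * b = c * c"
  shows "b = c"
proof -
  have comm_case: "x = y"
    if x: "positive_elem x" and y: "positive_elem y" and e: "x * x = y * y" and xy: "x * y = y * x"
    for x y :: 'a
  proof -
    define d where "d = x - y"
    have d: "star d = d" using x y by (simp add: d_def star_diff positive_selfadjoint)
    have "d * x = x * d" "d * y = y * d" using xy by (simp_all add: d_def algebra_simps)
    then have dx: "d * d * x = x * (d * d)" and dy: "d * d * y = y * (d * d)"
      by (metis mult.assoc)+
    have px: "positive_elem (d * d * x)" and py: "positive_elem (d * d * y)"
      by (intro positive_mult_commute positive_square x y d dx dy)+
    have "d * (x + y) = 0" using e xy by (simp add: d_def algebra_simps)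
    then have "d * d * (x + y) = 0" by (simp add: mult.assoc)
    then have s: "d * d * x + d * d * y = 0" by (simp add: distrib_left)
    then have "d * d * y = - (d * d * x)" by (simp add: add_eq_0_iff)
    then have zx: "d * d * x = 0" using positive_eq_zero[OF px] py by simp
    then have zy: "d * d * y = 0" using s by simp
    have "d * d * d = 0"
      using zx zy right_diff_distrib[of "d * d" x y] by (simp flip: d_def)
    \<comment> \<open>The fourth power of the self-adjoint d vanishes as well, and two applications
      of the C*-identity bring this down to d = 0.\<close>
    then have "(d * d) * (d * d) = 0" by (metis mult.assoc mult_zero_left)
    then have "norm (d * d) = 0"
      using norm_square_selfadjoint[of "d * d"] d by (simp add: star_mult)
    then have "norm d = 0" using norm_square_selfadjoint[OF d] by simp
    then show ?thesis by (simp add: d_def)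
  qed
  \<comment> \<open>It is not known that b and c commute, so both are compared with the constructed
    root u, which commutes with everything commuting with b^2 = c^2.\<close>
  obtain u where u: "positive_elem u" "u * u = b * b"
      "\<And>y. y * (b * b) = b * b * y \<Longrightarrow> y * u = u * y"
    by (rule positive_sqrt_exists[OF positive_square[OF positive_selfadjoint[OF b]]]) blast
  have "b * u = u * b" by (rule u(3)) (simp only: mult.assoc)
  then have "b = u" by (rule comm_case[OF b u(1) u(2)[symmetric]])
  moreover have "c * u = u * c" by (rule u(3)) (simp only: eq mult.assoc)
  then have "c = u" by (rule comm_case[OF c u(1) trans[OF eq[symmetric] u(2)[symmetric]]])
  ultimately show ?thesis by simp
qed

lemma
  fixes a :: "'a::unital_cstar_algebra"
  assumes "positive_elem a"
  shows positive_cstar_sqrt: "positive_elem (cstar_sqrt a)"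
    and cstar_sqrt_power2: "(cstar_sqrt a)\<^sup>2 = a"
proof -
  obtain b where b: "positive_elem b" "b * b = a"
    by (rule positive_sqrt_exists[OF assms]) blast
  have "\<exists>!b. positive_elem b \<and> b\<^sup>2 = a"
    by (rule ex1I[of _ b]) (use b positive_sqrt_unique in \<open>auto simp: power2_eq_square\<close>)
  then have "positive_elem (cstar_sqrt a) \<and> (cstar_sqrt a)\<^sup>2 = a"
    unfolding cstar_sqrt_def by (rule theI')
  then show "positive_elem (cstar_sqrt a)" "(cstar_sqrt a)\<^sup>2 = a" by auto
qed

text \<open>If u is the inverse of b, then b - s = b (1 - s u) is invertible for |s| < 1 / norm u,
  so the spectrum of b starts no earlier than this radius.\<close>

lemma positive_invertible_below:
  fixes b :: "'a::unital_cstar_algebra"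
  assumes b: "positive_elem b" and inv: "alg_invertible b"
  obtains d :: real where "d > 0" "positive_elem (b - of_real d)"
proof -
  obtain u where u: "b * u = 1" "u * b = 1" using inv alg_invertible_def by blast
  have "u \<noteq> 0" using u by auto
  define d where "d = 1 / norm u"
  have d: "d > 0" using \<open>u \<noteq> 0\<close> by (simp add: d_def)
  have sa: "star (b - of_real d) = b - of_real d" using b by (simp add: star_diff positive_selfadjoint)
  have "0 \<le> c" if c: "c \<in> spectrum (b - of_real d)" for c
  proof (rule ccontr)
    assume neg: "\<not> 0 \<le> c"
    have im: "Im c = 0" by (rule spectrum_selfadjoint_real[OF sa c])
    define r where "r = Re c"
    have cr: "c = complex_of_real r" using im by (simp add: r_def complex_eq_iff)
    with neg have r: "r < 0" by (simp add: less_eq_complex_def)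
    have in_b: "complex_of_real (r + d) \<in> spectrum b"
      using c spectrum_translate[of c "complex_of_real d" "b - of_real d"]
      by (simp add: cr cscale_of_real_one)
    then have "0 \<le> complex_of_real (r + d)" using b unfolding positive_elem_def by blast
    then have "0 \<le> r + d" by (simp add: less_eq_complex_def)
    then have "\<bar>r + d\<bar> * norm u < d * norm u" using r \<open>u \<noteq> 0\<close> by simp
    then have "norm ((r + d) *\<^sub>R u) < 1" using \<open>u \<noteq> 0\<close> by (simp add: d_def)
    then have "alg_invertible (b * (1 - (r + d) *\<^sub>R u))"
      by (intro alg_invertible_mult inv alg_invertible_one_minus)
    also have "b * (1 - (r + d) *\<^sub>R u) = - (of_real (r + d) - b)"
      using u by (simp add: right_diff_distrib of_real_def)
    finally show False
      using in_b by (simp only: of_real_in_spectrum_iff alg_invertible_uminus_iff not_True_eq_False)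
  qed
  with sa have "positive_elem (b - of_real d)" by (simp add: positive_elem_def)
  with d that show ?thesis by blast
qed

lemma alg_invertible_of_positive_below:
  fixes b :: "'a::unital_cstar_algebra"
  assumes d: "d > 0" and p: "positive_elem (b - of_real d)"
  shows "alg_invertible b"
proof (rule ccontr)
  assume "\<not> alg_invertible b"
  then have "complex_of_real (- d) \<in> spectrum (b - of_real d)"
    by (simp only: of_real_in_spectrum_iff) simp
  then have "0 \<le> complex_of_real (- d)" using p unfolding positive_elem_def by blast
  then show False using d by (simp add: less_eq_complex_def)
qed

text \<open>For a spectral value \<open>r < 0\<close> of \<open>a x a\<close>, the element \<open>a x a - r = a (x - r a\<^sup>-\<^sup>2) a\<close> would be
  invertible, since \<open>a\<^sup>-\<^sup>2\<close> is bounded below.\<close>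

lemma positive_conjugate:
  fixes a :: "'a::unital_cstar_algebra"
  assumes x: "positive_elem x" and a: "star a = a" and inv: "alg_invertible a"
  shows "positive_elem (a * x * a)"
proof -
  obtain u where u: "a * u = 1" "u * a = 1" using inv alg_invertible_def by blast
  have su: "star u = u" by (rule selfadjoint_inverse[OF u a])
  have "alg_invertible (u * u)"
    unfolding alg_invertible_square_iff using u by (auto simp: alg_invertible_def)
  then obtain d :: real where d: "d > 0" "positive_elem (u * u - of_real d)"
    using positive_invertible_below[OF positive_square[OF su]] by blast
  have sa: "star (a * x * a) = a * x * a"
    using a x by (simp add: star_mult positive_selfadjoint mult.assoc)
  have "0 \<le> c" if c: "c \<in> spectrum (a * x * a)" for c
  proof (rule ccontr)
    assume neg: "\<not> 0 \<le> c"
    have im: "Im c = 0" by (rule spectrum_selfadjoint_real[OF sa c])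
    define r where "r = Re c"
    have cr: "c = complex_of_real r" using im by (simp add: r_def complex_eq_iff)
    with neg have r: "r < 0" by (simp add: less_eq_complex_def)
    have "positive_elem (x + (- r) *\<^sub>R (u * u - of_real d))"
      using r d x by (intro positive_add positive_scaleR) auto
    then have "positive_elem (x - r *\<^sub>R (u * u) - of_real (- r * d))"
      by (simp add: of_real_def algebra_simps)
    then have "alg_invertible (x - r *\<^sub>R (u * u))"
      using r d(1) by (intro alg_invertible_of_positive_below[where d = "- r * d"]) (auto intro: mult_neg_pos)
    then have "alg_invertible (a * (x - r *\<^sub>R (u * u)) * a)"
      by (intro alg_invertible_mult inv)
    also have "a * (x - r *\<^sub>R (u * u)) * a = a * x * a - r *\<^sub>R ((a * u) * (u * a))"
      by (simp add: algebra_simps)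
    also have "\<dots> = - (of_real r - a * x * a)" by (simp add: u of_real_def)
    finally show False 
      using c by (simp only: cr of_real_in_spectrum_iff alg_invertible_uminus_iff not_True_eq_False)
  qed
  with sa show ?thesis by (simp add: positive_elem_def)
qed

section \<open>Linear functionals below a sublinear one\<close>

text \<open>Homogeneity is only an inequality for r > 0, the form that pointwise infima inherit
  directly; equality follows by applying it to r and to 1 / r.\<close>

definition sublinear :: "('v::real_vector \<Rightarrow> real) \<Rightarrow> bool" where
  "sublinear p \<longleftrightarrow> p 0 = 0 \<and> (\<forall>x y. p (x + y) \<le> p x + p y) \<and> (\<forall>r>0. \<forall>x. p (r *\<^sub>R x) \<le> r * p x)"

lemma sublinearI:
  assumes "p 0 = 0" "\<And>x y. p (x + y) \<le> p x + p y" "\<And>r x. r > 0 \<Longrightarrow> p (r *\<^sub>R x) \<le> r * p x"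
  shows "sublinear p"
  using assms by (simp add: sublinear_def)

lemma
  assumes "sublinear p"
  shows sublinear_zero: "p 0 = 0"
    and sublinear_add: "p (x + y) \<le> p x + p y"
    and sublinear_scale_le: "r > 0 \<Longrightarrow> p (r *\<^sub>R x) \<le> r * p x"
  using assms by (simp_all add: sublinear_def)

lemma sublinear_minus: "sublinear p \<Longrightarrow> - p (- x) \<le> p x"
  using sublinear_add[of p x "- x"] by (simp add: sublinear_zero)

lemma sublinear_scale:
  assumes p: "sublinear p" and r: "r > 0"
  shows "p (r *\<^sub>R x) = r * p x"
proof -
  have "p ((1 / r) *\<^sub>R (r *\<^sub>R x)) \<le> (1 / r) * p (r *\<^sub>R x)"
    by (rule sublinear_scale_le[OF p]) (use r in simp)
  then have "r * p x \<le> p (r *\<^sub>R x)" using r by (simp add: field_simps)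
  then show ?thesis using sublinear_scale_le[OF p r, of x] by simp
qed

text \<open>Lowers p so that it becomes odd along y. It serves twice: to prescribe the value at a
  given point, and to show that a minimal sublinear functional is odd.\<close>

lemma sublinear_shrink:
  assumes p: "sublinear p"
  obtains q where "sublinear q" "\<And>x. q x \<le> p x" "q (- y) \<le> - p y"
proof -
  define g where "g x t = p (x + t *\<^sub>R y) - t * p y" for x t
  define q where "q x = (INF t\<in>{0..}. g x t)" for x
  have sc: "p (t *\<^sub>R y) = t * p y" if "0 \<le> t" for t
    using that sublinear_scale[OF p, of t y] sublinear_zero[OF p] by (cases "t = 0") auto
  \<comment> \<open>Subadditivity and linearity of p on the ray through y keep the infimum
    finite.\<close>
  have lower: "- p (- x) \<le> g x t" if "0 \<le> t" for x t
    using sublinear_add[OF p, of "x + t *\<^sub>R y" "- x"] sc[OF that] by (simp add: g_def)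
  have bdd: "bdd_below (g x ` {0..})" for x
    using lower by (intro bdd_belowI2[where m = "- p (- x)"]) auto
  have qle: "q x \<le> g x t" if "0 \<le> t" for x t
    unfolding q_def by (rule cINF_lower[OF bdd]) (use that in simp)
  have leq: "m \<le> q x" if "\<And>t. 0 \<le> t \<Longrightarrow> m \<le> g x t" for m x
    unfolding q_def by (rule cINF_greatest) (use that in auto)
  show thesis
  proof
    show "sublinear q"
    proof (rule sublinearI)
      have "q 0 \<le> 0" using qle[of 0 0] by (simp add: g_def sublinear_zero[OF p])
      moreover have "0 \<le> q 0" by (rule leq) (simp add: g_def sc)
      ultimately show "q 0 = 0" by simp
    next
      fix x z
      have "q (x + z) \<le> g x s + g z t" if st: "0 \<le> s" "0 \<le> t" for s t
      proof -
        have "q (x + z) \<le> g (x + z) (s + t)" using st by (intro qle) simp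
        also have "x + z + (s + t) *\<^sub>R y = (x + s *\<^sub>R y) + (z + t *\<^sub>R y)"
          by (simp add: algebra_simps)
        then have "g (x + z) (s + t) \<le> g x s + g z t"
          using sublinear_add[OF p, of "x + s *\<^sub>R y" "z + t *\<^sub>R y"]
          by (simp add: g_def algebra_simps)
        finally show ?thesis .
      qed
      then have "q (x + z) - g z t \<le> q x" if "0 \<le> t" for t
        using that by (intro leq) (simp add: algebra_simps)
      then have "q (x + z) - q x \<le> q z"
        by (intro leq) (simp add: algebra_simps)
      then show "q (x + z) \<le> q x + q z" by simp
    next
      fix r :: real and x assume r: "r > 0"
      have "q (r *\<^sub>R x) / r \<le> q x"
      proof (rule leq)
        fix t :: real assume "0 \<le> t"
        have "g (r *\<^sub>R x) (r * t) = r * g x t"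
          using sublinear_scale[OF p r, of "x + t *\<^sub>R y"] by (simp add: g_def algebra_simps)
        then show "q (r *\<^sub>R x) / r \<le> g x t"
          using qle[of "r * t" "r *\<^sub>R x"] r \<open>0 \<le> t\<close> by (simp add: field_simps)
      qed
      then show "q (r *\<^sub>R x) \<le> r * q x" using r by (simp add: field_simps)
    qed
    show "q x \<le> p x" for x using qle[of 0 x] by (simp add: g_def)
    show "q (- y) \<le> - p y" using qle[of 1 "- y"] by (simp add: g_def sublinear_zero[OF p])
  qed
qed

text \<open>Zorn's lemma, with pointwise infima as bounds of chains. They are finite since every
  member is at least - p (- x), and subadditive since of two members of a chain one lies below
  both.\<close>

lemma sublinear_minimal:
  assumes p: "sublinear p"
  obtains m where "sublinear m" "\<And>x. m x \<le> p x"
    "\<And>q. sublinear q \<Longrightarrow> (\<And>x. q x \<le> m x) \<Longrightarrow> q = m"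
proof -
  define A where "A = {q. sublinear q \<and> (\<forall>x. q x \<le> p x)}"
  \<comment> \<open>Further up in \<open>P\<close> means pointwise smaller, so a maximal element is
    a minimal functional.\<close>
  define P where "P = (\<lambda>q q' :: 'a \<Rightarrow> real. \<forall>x. q' x \<le> q x)"
  have "\<exists>m\<in>A. \<forall>a\<in>A. P m a \<longrightarrow> a = m"
  proof (rule predicate_Zorn)
    show "partial_order_on A (relation_of P A)"
      by (rule partial_order_on_relation_ofI) (auto simp: P_def fun_eq_iff intro: order_trans order_antisym)
  next
    fix C assume C: "C \<in> Chains (relation_of P A)"
    have CA: "C \<subseteq> A" using C by (auto simp: Chains_def relation_of_def)
    have total: "P a b \<or> P b a" if "a \<in> C" "b \<in> C" for a b
      using C that by (auto simp: Chains_def relation_of_def)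
    show "\<exists>u\<in>A. \<forall>a\<in>C. P a u"
    proof (cases "C = {}")
      case True
      then show ?thesis using p by (auto simp: A_def)
    next
      case False
      define q where "q x = (INF c\<in>C. c x)" for x
      have sub: "sublinear c" and cp: "c x \<le> p x" if "c \<in> C" for c x
        using that CA by (auto simp: A_def)
      have "- p (- x) \<le> c x" if "c \<in> C" for c x
        using sublinear_minus[OF sub[OF that], of x] cp[OF that, of "- x"] by simp
      then have bdd: "bdd_below ((\<lambda>c. c x) ` C)" for x
        by (intro bdd_belowI2[where m = "- p (- x)"]) auto
      have qle: "q x \<le> c x" if "c \<in> C" for c x
        unfolding q_def by (rule cINF_lower[OF bdd that])
      have leq: "k \<le> q x" if "\<And>c. c \<in> C \<Longrightarrow> k \<le> c x" for k x
        unfolding q_def by (rule cINF_greatest[OF False that])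
      have "sublinear q"
      proof (rule sublinearI)
        obtain c where c: "c \<in> C" using False by blast
        have "q 0 \<le> 0" using qle[OF c, of 0] sublinear_zero[OF sub[OF c]] by simp
        moreover have "0 \<le> q 0" by (rule leq) (simp add: sublinear_zero sub)
        ultimately show "q 0 = 0" by simp
      next
        fix x y
        have "q (x + y) \<le> a x + b y" if ab: "a \<in> C" "b \<in> C" for a b
        proof -
          obtain c where c: "c \<in> C" "c x \<le> a x" "c y \<le> b y"
            using total[OF ab] ab unfolding P_def by blast
          have "q (x + y) \<le> c x + c y"
            using qle[OF c(1), of "x + y"] sublinear_add[OF sub[OF c(1)], of x y] by simp
          then show ?thesis using c by simp
        qed
        then have "q (x + y) - b y \<le> q x" if "b \<in> C" for b
          using that by (intro leq) (simp add: algebra_simps)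
        then have "q (x + y) - q x \<le> q y"
          by (intro leq) (simp add: algebra_simps)
        then show "q (x + y) \<le> q x + q y" by simp
      next
        fix r :: real and x assume r: "r > 0"
        have "q (r *\<^sub>R x) / r \<le> q x"
        proof (rule leq)
          fix c assume c: "c \<in> C"
          show "q (r *\<^sub>R x) / r \<le> c x"
            using qle[OF c, of "r *\<^sub>R x"] sublinear_scale_le[OF sub[OF c] r, of x] r
            by (simp add: field_simps)
        qed
        then show "q (r *\<^sub>R x) \<le> r * q x" using r by (simp add: field_simps)
      qed
      moreover have "q x \<le> p x" for x
        using False qle cp order_trans by blast
      ultimately have "q \<in> A" by (simp add: A_def)
      then show ?thesis using qle by (auto simp: P_def)
    qed
  qed
  then obtain m where m: "m \<in> A" "\<And>a. a \<in> A \<Longrightarrow> P m a \<Longrightarrow> a = m" by blast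
  show thesis
  proof
    show "sublinear m" "\<And>x. m x \<le> p x" using m(1) by (auto simp: A_def)
    fix q assume q: "sublinear q" "\<And>x. q x \<le> m x"
    then have "q \<in> A" using m(1) by (auto simp: A_def intro: order_trans)
    then show "q = m" using m(2) q(2) by (simp add: P_def)
  qed
qed

text \<open>A minimal sublinear functional cannot be shrunk along any z, so it is odd; an odd
  subadditive functional is additive. Shrinking p along y beforehand forces the value at y.\<close>

theorem hahn_banach_sublinear:
  assumes p: "sublinear p"
  obtains f where "linear f" "\<And>x. f x \<le> p x" "f y = p y"
proof -
  obtain p' where p': "sublinear p'" "\<And>x. p' x \<le> p x" "p' (- y) \<le> - p y"
    by (rule sublinear_shrink[OF p, of y]) blast
  obtain f where f: "sublinear f" "\<And>x. f x \<le> p' x"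
      and min: "\<And>q. sublinear q \<Longrightarrow> (\<And>x. q x \<le> f x) \<Longrightarrow> q = f"
    by (rule sublinear_minimal[OF p'(1)]) blast
  have neg: "f (- z) = - f z" for z
  proof -
    obtain q where q: "sublinear q" "\<And>x. q x \<le> f x" "q (- z) \<le> - f z"
      by (rule sublinear_shrink[OF f(1), of z]) blast
    have "q = f" by (rule min[OF q(1,2)])
    then show ?thesis using q(3) sublinear_minus[OF f(1), of z] by simp
  qed
  have add: "f (x + z) = f x + f z" for x z
    using sublinear_add[OF f(1), of x z] sublinear_add[OF f(1), of "x + z" "- z"] neg[of z] by simp
  have scale: "f (r *\<^sub>R x) = r * f x" for r x
  proof -
    have pos: "f (s *\<^sub>R x) = s * f x" if "s > 0" for s
      by (rule sublinear_scale[OF f(1) that])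
    consider "r = 0" | "r > 0" | "r < 0" by linarith
    then show ?thesis
    proof cases
      case 3
      then have "f (- ((- r) *\<^sub>R x)) = - (- r * f x)" using pos[of "- r"] neg by simp
      then show ?thesis by simp
    qed (use pos sublinear_zero[OF f(1)] in auto)
  qed
  have "linear f" by (rule linearI) (simp_all add: add scale)
  moreover have "f x \<le> p x" for x using f(2) p'(2) order_trans by blast
  moreover have "f y = p y"
    using f(2)[of "- y"] p'(3) neg[of y] \<open>f y \<le> p y\<close> by simp
  ultimately show thesis using that by blast
qed

section \<open>Strictly positive elements\<close>

lemma positive_of_real_iff [simp]:
  "positive_elem (of_real r :: 'a::unital_cstar_algebra) \<longleftrightarrow> 0 \<le> r"
proof
  assume "positive_elem (of_real r :: 'a)"
  moreover have "complex_of_real r \<in> spectrum (of_real r :: 'a)"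
    by (simp add: of_real_in_spectrum_iff alg_invertible_def)
  ultimately have "0 \<le> complex_of_real r" unfolding positive_elem_def by blast
  then show "0 \<le> r" by (simp add: less_eq_complex_def)
qed (rule positive_of_real)

lemma positive_limit_scalar:
  fixes a :: "'a::unital_cstar_algebra"
  assumes "\<And>e::real. e > 0 \<Longrightarrow> positive_elem (a + e *\<^sub>R b)"
  shows "positive_elem a"
proof (rule positive_limit)
  show "((\<lambda>e. a + e *\<^sub>R b) \<longlongrightarrow> a) (at_right (0::real))"
    by (rule tendsto_eq_intros refl | simp)+
  show "\<forall>\<^sub>F e in at_right 0. positive_elem (a + e *\<^sub>R b)"
    using assms by (auto simp: eventually_at_filter)
qed simp

text \<open>Twice the supremum of the spectrum of the real part.\<close>

definition real_part_gauge :: "'a::unital_cstar_algebra \<Rightarrow> real" where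
  "real_part_gauge a = Inf {s. positive_elem (of_real s - (a + star a))}"

lemma real_part_gauge_le:
  fixes a :: "'a::unital_cstar_algebra"
  assumes "positive_elem (of_real s - (a + star a))"
  shows "real_part_gauge a \<le> s"
proof -
  have "- norm (a + star a) \<le> t" if t: "positive_elem (of_real t - (a + star a))" for t
  proof -
    have "positive_elem (of_real (norm (a + star a)) - - (a + star a))"
      by (rule positive_diff_norm)
         (simp_all only: star_uminus star_add star_star add.commute norm_minus_cancel order_refl)
    from positive_add[OF t this]
    have "positive_elem (of_real (t + norm (a + star a)) :: 'a)" by simp
    then show ?thesis by (simp only: positive_of_real_iff)
  qed
  then show ?thesis
    unfolding real_part_gauge_def using assms
    by (intro cInf_lower bdd_belowI[where m = "- norm (a + star a)"]) auto
qed

text \<open>The infimum is attained because the cone is closed.\<close>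

lemma real_part_gauge_positive:
  fixes a :: "'a::unital_cstar_algebra"
  shows "positive_elem (of_real (real_part_gauge a) - (a + star a))"
proof (rule positive_limit_scalar[where b = 1])
  fix e :: real assume e: "e > 0"
  let ?S = "{s. positive_elem (of_real s - (a + star a))}"
  have "norm (a + star a) \<in> ?S"
    by (simp, rule positive_diff_norm) (simp_all add: star_add star_star add.commute)
  then have "\<exists>s\<in>?S. s < real_part_gauge a + e"
    unfolding real_part_gauge_def using e by (intro cInf_lessD) auto
  then obtain s where s: "positive_elem (of_real s - (a + star a))" "s < real_part_gauge a + e"
    by blast
  have "positive_elem ((of_real s - (a + star a)) + of_real (real_part_gauge a + e - s))"
    by (intro positive_add s(1) positive_of_real) (use s(2) in simp)
  then show "positive_elem (of_real (real_part_gauge a) - (a + star a) + e *\<^sub>R 1)"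
    by (simp add: of_real_def algebra_simps)
qed

lemma sublinear_real_part_gauge: "sublinear (real_part_gauge :: 'a::unital_cstar_algebra \<Rightarrow> real)"
proof (rule sublinearI)
  have "real_part_gauge (0::'a) \<le> 0" by (rule real_part_gauge_le) simp
  moreover have "0 \<le> real_part_gauge (0::'a)" using real_part_gauge_positive[of "0::'a"] by simp
  ultimately show "real_part_gauge (0::'a) = 0" by simp
next
  fix a b :: 'a
  show "real_part_gauge (a + b) \<le> real_part_gauge a + real_part_gauge b"
    using positive_add[OF real_part_gauge_positive[of a] real_part_gauge_positive[of b]]
    by (intro real_part_gauge_le) (simp add: star_add algebra_simps)
next
  fix r :: real and a :: 'a assume "r > 0"
  then show "real_part_gauge (r *\<^sub>R a) \<le> r * real_part_gauge a"
    using positive_scaleR[OF real_part_gauge_positive[of a], of r]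
    by (intro real_part_gauge_le) (simp add: of_real_def algebra_simps)
qed

lemma vector_space_cscale: "vector_space (cscale :: complex \<Rightarrow> 'a \<Rightarrow> 'a::unital_cstar_algebra)"
  by unfold_locales (simp_all add: cscale_add_right cscale_add_left cscale_cscale)

text \<open>The usual complexification f(a) - i f(i a). On skew b the gauge is at most 0 at b and at
  - b, so f vanishes there, and the form is real on self-adjoint elements.\<close>

lemma positive_form_of_gauge:
  fixes f :: "'a::unital_cstar_algebra \<Rightarrow> real"
  assumes f: "linear f" and le: "\<And>a. f a \<le> real_part_gauge a"
  defines "\<phi> \<equiv> \<lambda>a. Complex (f a) (- f (cscale \<i> a))"
  shows "positive_form \<phi>" "\<phi> \<noteq> (\<lambda>_. 0)"
proof -
  have skew: "f b = 0" if b: "b + star b = 0" for b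
  proof -
    have "real_part_gauge b \<le> 0" by (rule real_part_gauge_le) (simp add: b)
    moreover have "real_part_gauge (- b) \<le> 0"
      by (rule real_part_gauge_le) (use b in \<open>simp add: neg_eq_iff_add_eq_0 add.commute\<close>)
    ultimately show ?thesis using le[of b] le[of "- b"] linear_neg[OF f, of b] by simp
  qed
  have fi: "f (cscale \<i> (cscale \<i> a)) = - f a" for a
    using linear_neg[OF f, of a] by (simp add: cscale_cscale)
  have "\<phi> (cscale c a) = c * \<phi> a" for c a
  proof -
    have e: "cscale c a = Re c *\<^sub>R a + Im c *\<^sub>R cscale \<i> a" for a
    proof -
      have "cscale (complex_of_real (Re c) + complex_of_real (Im c) * \<i>) a
          = Re c *\<^sub>R a + Im c *\<^sub>R cscale \<i> a"
        by (simp only: cscale_add_left cscale_of_real flip: cscale_cscale)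
      moreover have "complex_of_real (Re c) + complex_of_real (Im c) * \<i> = c"
        by (simp add: complex_eq_iff)
      ultimately show ?thesis by simp
    qed
    have "f (cscale c a) = Re c * f a + Im c * f (cscale \<i> a)" for a
      by (simp add: e[of a] linear_add[OF f] linear_scale[OF f])
    moreover have "cscale \<i> (cscale c a) = cscale c (cscale \<i> a)"
      by (simp add: cscale_cscale mult.commute)
    ultimately show ?thesis by (simp add: \<phi>_def complex_eq_iff fi algebra_simps)
  qed
  moreover have "\<phi> (a + b) = \<phi> a + \<phi> b" for a b
    by (simp add: \<phi>_def complex_eq_iff cscale_add_right linear_add[OF f])
  moreover have "vector_space ((*) :: complex \<Rightarrow> complex \<Rightarrow> complex)"
    by unfold_locales (simp_all add: algebra_simps)
  ultimately have "Vector_Spaces.linear cscale (*) \<phi>"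
    by (simp add: Vector_Spaces.linear_iff vector_space_cscale)
  moreover have "0 \<le> \<phi> a" if a: "positive_elem a" for a
  proof -
    have sa: "star a = a" by (rule positive_selfadjoint[OF a])
    have "real_part_gauge (- a) \<le> 0"
      by (rule real_part_gauge_le) (simp add: sa positive_add[OF a a])
    then have "0 \<le> f a" using le[of "- a"] linear_neg[OF f, of a] by simp
    moreover have "f (cscale \<i> a) = 0"
      by (rule skew) (simp add: star_cscale sa cscale_of_real[of 0, simplified] flip: cscale_add_left)
    ultimately show ?thesis by (simp add: \<phi>_def less_eq_complex_def)
  qed
  ultimately show "positive_form \<phi>" by (simp add: positive_form_def)
  \<comment> \<open>The gauge is twice a supremum of the spectrum, hence the value 2.\<close>
  have "real_part_gauge (- 1 :: 'a) \<le> - 2" by (rule real_part_gauge_le) simp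
  then have "f 1 \<noteq> 0" using le[of "- 1"] linear_neg[OF f, of 1] by auto
  then have "\<phi> 1 \<noteq> 0" by (simp add: \<phi>_def complex_eq_iff)
  then show "\<phi> \<noteq> (\<lambda>_. 0)" by auto
qed

text \<open>Each dominated f satisfies f(a) > 0 and f(i a) = 0. Taking f to attain the gauge at i a
  and at - i a shows that both gauges vanish, so i a is skew and a is self-adjoint. Taking f to
  attain it at - a gives the lower bound.\<close>

lemma strictly_positive_below:
  fixes a :: "'a::unital_cstar_algebra"
  assumes a: "strictly_positive a"
  obtains d :: real where "d > 0" "positive_elem (a - of_real d)"
proof -
  have form: "0 < f a \<and> f (cscale \<i> a) = 0"
    if "linear f" "\<And>b. f b \<le> real_part_gauge b" for f :: "'a \<Rightarrow> real"
  proof -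
    have "0 < Complex (f a) (- f (cscale \<i> a))"
      using a positive_form_of_gauge[OF that] unfolding strictly_positive_def by blast
    then show ?thesis by (simp add: less_complex_def)
  qed
  have val: "\<exists>f. linear f \<and> (\<forall>b. f b \<le> real_part_gauge b) \<and> f c = real_part_gauge c" for c :: 'a
    by (rule hahn_banach_sublinear[OF sublinear_real_part_gauge, of c]) blast
  obtain f where f: "linear f" "\<And>b. f b \<le> real_part_gauge b" "f (- a) = real_part_gauge (- a)"
    using val by blast
  \<comment> \<open>This bounds \<open>a + star a\<close>, that is 2 a, from below; the bound for a
    is therefore d / 2.\<close>
  define d where "d = - real_part_gauge (- a)"
  have d: "d > 0" using form[OF f(1,2)] f(3) linear_neg[OF f(1), of a] by (simp add: d_def)
  have p: "positive_elem (a + star a - of_real d)"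
    using real_part_gauge_positive[of "- a"] by (simp add: d_def algebra_simps)
  define k where "k = cscale \<i> a"
  have "real_part_gauge k = 0" using val[of k] form k_def by metis
  moreover have "real_part_gauge (- k) = 0" using val[of "- k"] form linear_neg k_def
    by (metis neg_equal_0_iff_equal)
  ultimately have "positive_elem (- (k + star k))" "positive_elem (k + star k)"
    using real_part_gauge_positive[of k] real_part_gauge_positive[of "- k"] by (simp_all add: algebra_simps)
  then have "k + star k = 0" using positive_eq_zero by blast
  then have "cscale \<i> (cscale \<i> (star a)) = cscale \<i> (cscale \<i> a)"
  proof -
    have "star k = - cscale \<i> (star a)"
      unfolding k_def star_cscale complex_cnj_i
      by (metis cscale_cscale cscale_minus_one mult_minus1)
    then have "cscale \<i> a = cscale \<i> (star a)" using \<open>k + star k = 0\<close> by (simp add: k_def)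
    then show ?thesis by simp
  qed
  then have sa: "star a = a" by (simp add: cscale_cscale)
  have "positive_elem ((1/2) *\<^sub>R (a + star a - of_real d))"
    by (intro positive_scaleR p) simp
  also have "(1/2) *\<^sub>R (a + star a - of_real d) = a - of_real (d / 2)"
    by (simp add: sa of_real_def scaleR_right_diff_distrib flip: scaleR_2)
  finally show thesis using that[of "d / 2"] d by simp
qed

text \<open>Only the case of the unit matters. A positive form vanishing at 1 vanishes on
  self-adjoint a, since norm a - a and norm a + a are positive, and hence everywhere by splitting
  into self-adjoint parts.\<close>

lemma strictly_positive_of_real:
  assumes r: "r > 0"
  shows "strictly_positive (of_real r :: 'a::unital_cstar_algebra)"
  unfolding strictly_positive_def
proof (intro allI impI, elim conjE)
  fix \<phi> :: "'a \<Rightarrow> complex"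
  assume pf: "positive_form \<phi>" and nz: "\<phi> \<noteq> (\<lambda>_. 0)"
  have add: "\<phi> (a + b) = \<phi> a + \<phi> b" and sc: "\<phi> (cscale c a) = c * \<phi> a" for a b c
    using pf by (simp_all add: positive_form_def Vector_Spaces.linear_iff)
  have pos: "positive_elem a \<Longrightarrow> 0 \<le> \<phi> a" for a
    using pf by (simp add: positive_form_def)
  have real: "\<phi> (of_real s) = complex_of_real s * \<phi> 1" for s
    by (metis cscale_of_real_one sc)
  have minus: "\<phi> (- a) = - \<phi> a" for a using sc[of "- 1" a] by simp
  have "\<phi> 1 \<noteq> 0"
  proof
    assume z: "\<phi> 1 = 0"
    have sa: "\<phi> a = 0" if a: "star a = a" for a
    proof -
      have "0 \<le> \<phi> (of_real (norm a) - a)" "0 \<le> \<phi> (of_real (norm a) - (- a))"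
        using a by (auto intro!: pos positive_diff_norm simp del: diff_minus_eq_add)
      then have "0 \<le> - \<phi> a" "0 \<le> \<phi> a"
        using add[of "of_real (norm a)" "- a"] by (simp_all add: add minus real z)
      then show ?thesis by (simp add: less_eq_complex_def complex_eq_iff)
    qed
    have "\<phi> a = 0" for a
    proof -
      have "\<phi> (a + star a) = 0" by (rule sa) (simp add: star_add star_star add.commute)
      moreover have "\<phi> (cscale \<i> (a - star a)) = 0"
        by (rule sa) (metis (no_types, lifting) complex_cnj_i cscale_cscale cscale_minus_one
            minus_diff_eq mult_minus1 mult_minus1_right star_cscale star_diff star_star)
      ultimately show ?thesis
        using sc[of \<i> "a - star a"] add[of a "- star a"] by (simp add: add minus)
    qed
    with nz show False by auto
  qed
  moreover have "0 \<le> \<phi> 1" using pos[of "of_real 1"] by (simp del: of_real_1 add: positive_of_real) simp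
  ultimately have "0 < \<phi> 1" by (simp add: less_le)
  then show "0 < \<phi> (of_real r)" using r by (simp add: real less_complex_def)
qed

section \<open>Hilbert modules\<close>

context hilbert_module
begin

lemma mod_abs_power2 [simp]: "(mod_abs ip x)\<^sup>2 = ip x x"
  unfolding mod_abs_def by (rule cstar_sqrt_power2[OF ip_positive])

lemma norm_ip: "norm (ip x x) = (norm x)\<^sup>2"
proof -
  have "star (mod_abs ip x) = mod_abs ip x"
    unfolding mod_abs_def by (intro positive_selfadjoint positive_cstar_sqrt ip_positive)
  then have "norm (mod_abs ip x * mod_abs ip x) = (norm (mod_abs ip x))\<^sup>2"
    by (rule norm_square_selfadjoint)
  then show ?thesis by (simp add: norm_eq flip: power2_eq_square)
qed

lemma ip_add_right: "ip x (y + z) = ip x y + ip x z"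
  by (metis ip_add_left ip_star star_add)

lemma ip_act_right: "ip x (act a y) = ip x y * star a"
  by (metis ip_act_left ip_star star_mult)

lemma ip_scaleR_left: "ip (r *\<^sub>R x) y = r *\<^sub>R ip x y"
  by (simp add: ip_act_left of_real_def flip: act_of_real)

lemma ip_scaleR_right: "ip x (r *\<^sub>R y) = r *\<^sub>R ip x y"
  by (metis ip_scaleR_left ip_star star_scaleR)

lemma ip_minus_left: "ip (- x) y = - ip x y"
  using ip_scaleR_left[of "- 1" x y] by simp

lemma ip_minus_right: "ip x (- y) = - ip x y"
  using ip_scaleR_right[of x "- 1" y] by simp

lemma ip_diff_left: "ip (x - y) z = ip x z - ip y z"
  by (metis diff_conv_add_uminus ip_add_left ip_minus_left)

lemma ip_diff_right: "ip x (y - z) = ip x y - ip x z"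
  by (metis diff_conv_add_uminus ip_add_right ip_minus_right)

lemma act_minus: "act a (- x) = - act a x"
proof -
  have "act a 0 + act a 0 = act a 0" using act_add_right[of a 0 0] by simp
  then have "act a x + act a (- x) = 0" using act_add_right[of a x "- x"] by simp
  then show ?thesis by (simp add: add_eq_0_iff)
qed

lemma act_diff: "act a (x - y) = act a x - act a y"
  by (metis act_add_right act_minus diff_conv_add_uminus)

lemma norm_act_le: "norm (act a x) \<le> norm a * norm x"
proof -
  have "(norm (act a x))\<^sup>2 = norm (a * ip x x * star a)"
    by (simp add: ip_act_left ip_act_right mult.assoc flip: norm_ip)
  also have "\<dots> \<le> norm a * norm (ip x x) * norm (star a)"
    by (meson mult_right_mono norm_ge_zero norm_mult_ineq order_trans)
  also have "\<dots> = (norm a * norm x)\<^sup>2"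
    by (simp add: norm_ip power2_eq_square)
  finally show ?thesis by (rule power2_le_imp_le) simp
qed

text \<open>The difference is exactly the square of sqrt d y + z / sqrt d. This is the triangle
  inequality in the form that makes sense with values in the algebra.\<close>

lemma ip_diff_le:
  assumes d: "d > 0"
  shows "positive_elem ((1 + d) *\<^sub>R ip y y + (1 + 1 / d) *\<^sub>R ip z z - ip (y - z) (y - z))"
proof -
  have "positive_elem (ip (sqrt d *\<^sub>R y + (1 / sqrt d) *\<^sub>R z) (sqrt d *\<^sub>R y + (1 / sqrt d) *\<^sub>R z))"
    by (rule ip_positive)
  also have "ip (sqrt d *\<^sub>R y + (1 / sqrt d) *\<^sub>R z) (sqrt d *\<^sub>R y + (1 / sqrt d) *\<^sub>R z) =
      (1 + d) *\<^sub>R ip y y + (1 + 1 / d) *\<^sub>R ip z z - ip (y - z) (y - z)"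
    using d by (simp add: ip_add_left ip_add_right ip_scaleR_left ip_scaleR_right ip_diff_left
        ip_diff_right algebra_simps)
  finally show ?thesis .
qed

text \<open>Applying the norm inequality to \<open>(q\<^sub>2 x + e)\<^bsup>-1/2\<^esup> x\<close> and conjugating back by
  \<open>(q\<^sub>2 x + e)\<^bsup>1/2\<^esup>\<close> turns it into an inequality in the algebra.\<close>

lemma le_of_norm_le:
  assumes p: "\<And>x. positive_elem (q1 x)" "\<And>x. positive_elem (q2 x)"
    and hom: "\<And>a x. q1 (act a x) = a * q1 x * star a" "\<And>a x. q2 (act a x) = a * q2 x * star a"
    and C: "0 \<le> C" and le: "\<And>x. norm (q1 x) \<le> C * norm (q2 x)"
  shows "positive_elem (C *\<^sub>R q2 x - q1 x)"
proof (rule positive_limit_scalar[where b = "of_real C"])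
  fix e :: real assume e: "e > 0"
  \<comment> \<open>\<open>q2 x\<close> alone need not be invertible; the error caused by e
    disappears in the limit.\<close>
  define s where "s = q2 x + of_real e"
  have "positive_elem (s - of_real e)" using p by (simp add: s_def)
  then have s: "positive_elem s" "alg_invertible s"
    using e by (auto simp: s_def intro: positive_add p alg_invertible_of_positive_below)
  obtain b where b: "positive_elem b" "b * b = s"
    by (rule positive_sqrt_exists[OF s(1)]) blast
  have bs: "star b = b" and bi: "alg_invertible b"
    using b s(2) by (auto simp: positive_selfadjoint simp flip: alg_invertible_square_iff[of b])
  obtain a where a: "b * a = 1" "a * b = 1" using bi alg_invertible_def by blast
  have as: "star a = a" by (rule selfadjoint_inverse[OF a bs])
  have ai: "alg_invertible a" using a alg_invertible_def by blast
  have q2b: "q2 x = b * b - of_real e" by (simp add: b(2) s_def)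
  have "a * q2 x * a = (a * b) * (b * a) - e *\<^sub>R (a * a)"
    by (simp add: q2b of_real_def algebra_simps)
  \<comment> \<open>So a q2(x) a is at most 1, and the norm hypothesis at \<open>act a x\<close>
    bounds a q1(x) a by C.\<close>
  then have q2: "1 - a * q2 x * a = e *\<^sub>R (a * a)" using a by simp
  have "norm (a * q2 x * a) \<le> norm (1::'a)"
    by (rule norm_mono_positive)
       (auto simp: q2 intro!: positive_conjugate positive_scaleR positive_square p as ai less_imp_le[OF e])
  then have "norm (a * q1 x * a) \<le> C * 1"
    using order_trans[OF le[of "act a x"] mult_left_mono[OF _ C, of _ 1]]
    by (simp add: hom as)
  then have "positive_elem (of_real C - a * q1 x * a)"
    by (intro positive_diff_norm) (simp_all add: star_mult as positive_selfadjoint p mult.assoc)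
  then have "positive_elem (b * (of_real C - a * q1 x * a) * b)"
    by (rule positive_conjugate[OF _ bs bi])
  also have "b * (of_real C - a * q1 x * a) * b = C *\<^sub>R (b * b) - (b * a) * q1 x * (a * b)"
    by (simp add: of_real_def algebra_simps)
  also have "\<dots> = C *\<^sub>R q2 x - q1 x + e *\<^sub>R of_real C"
    by (simp add: a b(2) s_def of_real_def algebra_simps)
  finally show "positive_elem (C *\<^sub>R q2 x - q1 x + e *\<^sub>R of_real C)" .
qed

end

section \<open>Orthogonal projections\<close>

context hilbert_module
begin

context
  fixes K assumes K: "K \<in> complemented_submodules act ip"
begin

lemma complemented_diff: "x \<in> K \<Longrightarrow> y \<in> K \<Longrightarrow> x - y \<in> K"
proof -
  assume "x \<in> K" "y \<in> K"
  then have "x + act (of_real (- 1)) y \<in> K"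
    using K by (simp add: complemented_submodules_def submodule_def del: of_real_minus)
  then show ?thesis by (simp only: act_of_real) simp
qed

lemma orth_proj_eqI:
  assumes u: "u \<in> K" "x - u \<in> orth_compl ip K"
  shows "orth_proj ip K x = u"
  unfolding orth_proj_def
proof (rule the_equality)
  fix v assume v: "v \<in> K \<and> x - v \<in> orth_compl ip K"
  have "v - u \<in> K" using u v complemented_diff by blast
  moreover have "v - u \<in> orth_compl ip K"
  proof -
    have "v - u = (x - u) - (x - v)" by simp
    then show ?thesis using u v by (simp only: orth_compl_def mem_Collect_eq ip_diff_left) simp
  qed
  ultimately have "v - u \<in> K \<inter> orth_compl ip K" by blast
  moreover have "K \<inter> orth_compl ip K = {0}" using K by (simp add: complemented_submodules_def)
  ultimately have "v - u \<in> {0}" by blast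
  then show "v = u" by simp
qed (use u in simp)

lemma orth_proj: "orth_proj ip K x \<in> K" "x - orth_proj ip K x \<in> orth_compl ip K"
proof -
  obtain u v where uv: "u \<in> K" "v \<in> orth_compl ip K" "x = u + v"
    using K unfolding complemented_submodules_def by blast
  then have "orth_proj ip K x = u" by (intro orth_proj_eqI) auto
  then show "orth_proj ip K x \<in> K" "x - orth_proj ip K x \<in> orth_compl ip K" using uv by auto
qed

lemma orth_proj_add: "orth_proj ip K (x + y) = orth_proj ip K x + orth_proj ip K y"
proof (rule orth_proj_eqI)
  show "orth_proj ip K x + orth_proj ip K y \<in> K"
    using K orth_proj by (simp add: complemented_submodules_def submodule_def)
  show "x + y - (orth_proj ip K x + orth_proj ip K y) \<in> orth_compl ip K"
    using orth_proj(2)[of x] orth_proj(2)[of y]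
    by (simp add: orth_compl_def ip_diff_left ip_add_left)
qed

lemma orth_proj_act: "orth_proj ip K (act a x) = act a (orth_proj ip K x)"
proof (rule orth_proj_eqI)
  show "act a (orth_proj ip K x) \<in> K"
    using K orth_proj by (simp add: complemented_submodules_def submodule_def)
  show "act a x - act a (orth_proj ip K x) \<in> orth_compl ip K"
    using orth_proj(2)[of x] by (simp add: orth_compl_def ip_act_left flip: act_diff)
qed

text \<open>Pythagoras: |x|^2 - |P x|^2 = |x - P x|^2 is positive.\<close>

lemma norm_orth_proj_le: "norm (orth_proj ip K x) \<le> norm x"
proof -
  let ?P = "orth_proj ip K x"
  have o: "ip (x - ?P) ?P = 0" using orth_proj by (simp add: orth_compl_def)
  then have o': "ip ?P (x - ?P) = 0" by (metis ip_star star_zero)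
  have "ip x x - ip ?P ?P = ip (x - ?P) (x - ?P)"
    using o o' by (simp add: ip_diff_left ip_diff_right)
  then have "norm (ip ?P ?P) \<le> norm (ip x x)"
    by (intro norm_mono_positive) (simp_all add: ip_positive)
  then show ?thesis by (simp add: norm_ip)
qed

lemma bounded_linear_orth_proj: "bounded_linear (orth_proj ip K)"
proof (rule bounded_linear_intro[where K = 1])
  show "orth_proj ip K (r *\<^sub>R x) = r *\<^sub>R orth_proj ip K x" for r x
    by (simp add: orth_proj_act flip: act_of_real)
qed (simp_all add: orth_proj_add norm_orth_proj_le)

end

lemma
  assumes "U \<in> complemented_submodules act ip" "V \<in> complemented_submodules act ip"
  shows bounded_linear_proj_diff: "bounded_linear (\<lambda>x. orth_proj ip U x - orth_proj ip V x)"
    and norm_proj_diff_le: "norm (orth_proj ip U x - orth_proj ip V x) \<le> sub_dist ip U V * norm x"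
    and sub_dist_nonneg: "0 \<le> sub_dist ip U V"
proof -
  show b: "bounded_linear (\<lambda>x. orth_proj ip U x - orth_proj ip V x)"
    by (intro bounded_linear_sub bounded_linear_orth_proj assms)
  show "norm (orth_proj ip U x - orth_proj ip V x) \<le> sub_dist ip U V * norm x" "0 \<le> sub_dist ip U V"
    unfolding sub_dist_def using onorm[OF b] onorm_pos_le[OF b] by auto
qed

lemma sub_dist_triangle:
  assumes "U \<in> complemented_submodules act ip" "V \<in> complemented_submodules act ip"
    "W \<in> complemented_submodules act ip"
  shows "sub_dist ip U W \<le> sub_dist ip U V + sub_dist ip V W"
  unfolding sub_dist_def
  using onorm_triangle[OF bounded_linear_proj_diff[OF assms(1,2)] bounded_linear_proj_diff[OF assms(2,3)]]
  by simp

lemma sub_dist_self: "sub_dist ip U U = 0"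
  by (simp add: sub_dist_def onorm_zero)

end

section \<open>Weighted sums of projections\<close>

text \<open>Monotonicity of the norm on positive elements applies to finite blocks, so the Cauchy
  criterion transfers without absolute convergence.\<close>

lemma summable_positive_dominated:
  fixes f g :: "nat \<Rightarrow> 'a::unital_cstar_algebra"
  assumes "summable g" "\<And>n. positive_elem (f n)" "\<And>n. positive_elem (g n - f n)"
  shows "summable f"
  unfolding summable_Cauchy
proof (intro allI impI)
  fix e :: real assume "0 < e"
  then obtain N where N: "\<And>m n. m \<ge> N \<Longrightarrow> norm (sum g {m..<n}) < e"
    using assms(1) unfolding summable_Cauchy by blast
  have "norm (sum f {m..<n}) \<le> norm (sum g {m..<n})" for m n
    by (rule norm_mono_positive) (simp_all add: assms positive_sum flip: sum_subtractf)
  then show "\<exists>N. \<forall>m\<ge>N. \<forall>n. norm (sum f {m..<n}) < e"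
    using N order_le_less_trans by blast
qed

lemma weight_central: "weight \<omega> \<Longrightarrow> (\<omega> n)\<^sup>2 * a = a * (\<omega> n)\<^sup>2"
  unfolding weight_def power2_eq_square by (metis mult.assoc)

lemma strictly_positive_positive: "strictly_positive a \<Longrightarrow> positive_elem a"
  using positive_add[of "a - of_real d" "of_real d" for d] positive_of_real
  by (metis diff_add_cancel less_imp_le strictly_positive_below)

lemma strictly_positive_invertible: "strictly_positive a \<Longrightarrow> alg_invertible a"
  by (metis alg_invertible_of_positive_below strictly_positive_below)

lemma positive_weight_mult:
  assumes "weight \<omega>" "positive_elem a"
  shows "positive_elem ((\<omega> n)\<^sup>2 * a)"
proof (rule positive_mult_commute[OF _ assms(2) weight_central[OF assms(1)]])
  have "star (\<omega> n) = \<omega> n"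
    using assms(1) by (simp add: weight_def strictly_positive_positive positive_selfadjoint)
  then show "positive_elem ((\<omega> n)\<^sup>2)" by (simp add: power2_eq_square positive_square)
qed

context hilbert_module
begin

lemma complemented_seqsD: "U \<in> complemented_seqs act ip \<Longrightarrow> U n \<in> complemented_submodules act ip"
  by (simp add: complemented_seqs_def)

lemma proj_sum_act:
  assumes w: "weight \<omega>" and U: "U \<in> complemented_seqs act ip"
    and s: "summable (\<lambda>n. (\<omega> n)\<^sup>2 * ip (orth_proj ip (U n) x) (orth_proj ip (U n) x))"
  shows "(\<Sum>n. (\<omega> n)\<^sup>2 * ip (orth_proj ip (U n) (act a x)) (orth_proj ip (U n) (act a x))) =
    a * (\<Sum>n. (\<omega> n)\<^sup>2 * ip (orth_proj ip (U n) x) (orth_proj ip (U n) x)) * star a"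
proof -
  have "(\<omega> n)\<^sup>2 * ip (orth_proj ip (U n) (act a x)) (orth_proj ip (U n) (act a x)) =
      a * ((\<omega> n)\<^sup>2 * ip (orth_proj ip (U n) x) (orth_proj ip (U n) x)) * star a" for n
    using weight_central[OF w, of n a]
    by (simp add: orth_proj_act[OF complemented_seqsD[OF U]] ip_act_left ip_act_right)
       (metis mult.assoc)
  then show ?thesis
    by (simp add: suminf_mult2[OF summable_mult[OF s], symmetric] suminf_mult[OF s, symmetric])
qed

text \<open>The difference series converges absolutely: norm (omega_n^2) is at most the weight used
  in the distance. The frame series themselves are only assumed to converge in norm.\<close>

lemma proj_diff_terms:
  assumes U: "U \<in> complemented_seqs act ip" and V: "V \<in> complemented_seqs act ip"
    and sum: "summable (\<lambda>n. weight_norms \<omega> n * (sub_dist ip (U n) (V n))\<^sup>2)"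
    and le: "(\<Sum>n. weight_norms \<omega> n * (sub_dist ip (U n) (V n))\<^sup>2) \<le> D\<^sup>2"
  defines "t \<equiv> \<lambda>x n. (\<omega> n)\<^sup>2 * ip (orth_proj ip (U n) x - orth_proj ip (V n) x)
      (orth_proj ip (U n) x - orth_proj ip (V n) x)"
  shows "summable (t x)" "norm (suminf (t x)) \<le> D\<^sup>2 * (norm x)\<^sup>2"
proof -
  have b: "norm (t x n) \<le> weight_norms \<omega> n * (sub_dist ip (U n) (V n))\<^sup>2 * (norm x)\<^sup>2" for n
  proof -
    have "(norm (orth_proj ip (U n) x - orth_proj ip (V n) x))\<^sup>2 \<le> (sub_dist ip (U n) (V n) * norm x)\<^sup>2"
      by (intro power_mono norm_proj_diff_le complemented_seqsD U V) simp
    moreover have "norm ((\<omega> n)\<^sup>2) \<le> (norm (\<omega> n))\<^sup>2" by (rule norm_power_ineq)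
    ultimately have "norm ((\<omega> n)\<^sup>2) * (norm (orth_proj ip (U n) x - orth_proj ip (V n) x))\<^sup>2
        \<le> (norm (\<omega> n))\<^sup>2 * (sub_dist ip (U n) (V n) * norm x)\<^sup>2"
      by (intro mult_mono) auto
    then show ?thesis
      unfolding t_def
      by (intro order_trans[OF norm_mult_ineq])
         (simp add: weight_norms_def norm_ip power_mult_distrib mult.assoc)
  qed
  have s: "summable (\<lambda>n. weight_norms \<omega> n * (sub_dist ip (U n) (V n))\<^sup>2 * (norm x)\<^sup>2)"
    by (rule summable_mult2[OF sum])
  show "summable (t x)" by (rule summable_comparison_test'[OF s]) (rule b)
  have sn: "summable (\<lambda>n. norm (t x n))"
    by (rule summable_comparison_test'[OF s]) (simp add: b)
  have "norm (suminf (t x)) \<le> (\<Sum>n. norm (t x n))" by (rule summable_norm[OF sn])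
  also have "\<dots> \<le> (\<Sum>n. weight_norms \<omega> n * (sub_dist ip (U n) (V n))\<^sup>2 * (norm x)\<^sup>2)"
    by (rule suminf_le[OF b sn s])
  also have "\<dots> \<le> D\<^sup>2 * (norm x)\<^sup>2"
    by (simp add: suminf_mult2[OF sum, symmetric] mult_right_mono le)
  finally show "norm (suminf (t x)) \<le> D\<^sup>2 * (norm x)\<^sup>2" .
qed

text \<open>Applies \<open>ip_diff_le\<close> to v = u - (u - v) and multiplies by the positive
  central weight.\<close>

lemma proj_terms_le:
  assumes w: "weight \<omega>" and d: "d > 0"
  shows "positive_elem ((1 + d) *\<^sub>R ((\<omega> n)\<^sup>2 * ip u u)
      + (1 + 1 / d) *\<^sub>R ((\<omega> n)\<^sup>2 * ip (u - v) (u - v)) - (\<omega> n)\<^sup>2 * ip v v)"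
  using positive_weight_mult[OF w ip_diff_le[OF d, of u "u - v"], of n]
  by (simp add: distrib_left right_diff_distrib)

text \<open>Used in both directions: once with u from the given frame, once with the roles of u and
  v exchanged.\<close>

lemma proj_sum_norm_le:
  assumes w: "weight \<omega>" and d: "d > 0"
    and su: "summable (\<lambda>n. (\<omega> n)\<^sup>2 * ip (u n) (u n))"
    and sv: "summable (\<lambda>n. (\<omega> n)\<^sup>2 * ip (v n) (v n))"
    and sr: "summable (\<lambda>n. (\<omega> n)\<^sup>2 * ip (u n - v n) (u n - v n))"
  shows "norm (\<Sum>n. (\<omega> n)\<^sup>2 * ip (v n) (v n)) \<le>
      (1 + d) * norm (\<Sum>n. (\<omega> n)\<^sup>2 * ip (u n) (u n)) +
      (1 + 1 / d) * norm (\<Sum>n. (\<omega> n)\<^sup>2 * ip (u n - v n) (u n - v n))"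
proof -
  let ?u = "\<Sum>n. (\<omega> n)\<^sup>2 * ip (u n) (u n)" and ?v = "\<Sum>n. (\<omega> n)\<^sup>2 * ip (v n) (v n)"
    and ?r = "\<Sum>n. (\<omega> n)\<^sup>2 * ip (u n - v n) (u n - v n)"
  have "positive_elem (\<Sum>n. (1 + d) *\<^sub>R ((\<omega> n)\<^sup>2 * ip (u n) (u n))
      + (1 + 1 / d) *\<^sub>R ((\<omega> n)\<^sup>2 * ip (u n - v n) (u n - v n)) - (\<omega> n)\<^sup>2 * ip (v n) (v n))"
    by (intro positive_suminf proj_terms_le w d summable_diff summable_add summable_scaleR_right su sv sr)
  also have "(\<Sum>n. (1 + d) *\<^sub>R ((\<omega> n)\<^sup>2 * ip (u n) (u n))
      + (1 + 1 / d) *\<^sub>R ((\<omega> n)\<^sup>2 * ip (u n - v n) (u n - v n)) - (\<omega> n)\<^sup>2 * ip (v n) (v n)) =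
      (1 + d) *\<^sub>R ?u + (1 + 1 / d) *\<^sub>R ?r - ?v"
    by (intro sums_unique[symmetric] sums_diff sums_add sums_scaleR_right summable_sums su sv sr)
  finally have "norm ?v \<le> norm ((1 + d) *\<^sub>R ?u + (1 + 1 / d) *\<^sub>R ?r)"
    by (intro norm_mono_positive positive_suminf sv positive_weight_mult w ip_positive)
  also have "\<dots> \<le> norm ((1 + d) *\<^sub>R ?u) + norm ((1 + 1 / d) *\<^sub>R ?r)" by (rule norm_triangle_ineq)
  finally show ?thesis using d by simp
qed

end

section \<open>The distance between sequences\<close>

lemma ennreal_sqrt_le_iff:
  assumes "0 \<le> c"
  shows "ennreal_sqrt S \<le> ennreal c \<longleftrightarrow> S \<le> ennreal (c\<^sup>2)"
proof (cases S rule: ennreal_cases)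
  case (real s)
  have "sqrt s \<le> c \<longleftrightarrow> s \<le> c\<^sup>2"
    using assms real(2) by (metis real_le_lsqrt real_sqrt_le_iff real_sqrt_unique sqrt_le_D)
  then show ?thesis using assms real by (simp add: ennreal_sqrt_def)
qed (simp add: ennreal_sqrt_def top_unique)

text \<open>Reduces the extended-real distance to finite real sums, which is how both the triangle
  inequality and summability are obtained from it.\<close>

lemma seq_dist_le_iff:
  assumes w: "\<And>n. 0 \<le> w n" and c: "0 \<le> c"
  shows "seq_dist ip w U V \<le> ennreal c \<longleftrightarrow>
    (\<forall>N. (\<Sum>n<N. w n * (sub_dist ip (U n) (V n))\<^sup>2) \<le> c\<^sup>2)"
proof -
  have "(\<Sum>n. ennreal (w n * (sub_dist ip (U n) (V n))\<^sup>2)) \<le> ennreal (c\<^sup>2) \<longleftrightarrow>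
      (\<forall>N. (\<Sum>n<N. ennreal (w n * (sub_dist ip (U n) (V n))\<^sup>2)) \<le> ennreal (c\<^sup>2))"
    by (simp add: suminf_eq_SUP SUP_le_iff)
  also have "\<dots> \<longleftrightarrow> (\<forall>N. (\<Sum>n<N. w n * (sub_dist ip (U n) (V n))\<^sup>2) \<le> c\<^sup>2)"
    using w by (simp add: sum_ennreal)
  finally show ?thesis by (simp add: seq_dist_def ennreal_sqrt_le_iff[OF c])
qed

lemma ennreal_less_obtain_real:
  assumes "t < ennreal r"
  obtains D where "0 \<le> D" "D < r" "t = ennreal D"
  using assms by (cases t rule: ennreal_cases) (auto simp: ennreal_less_iff)

context hilbert_module
begin

text \<open>As distances may be infinite, the inequality is stated through finite bounds c and e. On
  partial sums it is Minkowski's inequality, with the root of the weight absorbed into each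
  entry.\<close>

lemma seq_dist_triangle:
  assumes w: "\<And>n. 0 \<le> w n"
    and U: "U \<in> complemented_seqs act ip" and V: "V \<in> complemented_seqs act ip"
    and W: "W \<in> complemented_seqs act ip"
    and c: "0 \<le> c" "seq_dist ip w U V \<le> ennreal c"
    and e: "0 \<le> e" "seq_dist ip w V W \<le> ennreal e"
  shows "seq_dist ip w U W \<le> ennreal (c + e)"
proof -
  let ?f = "\<lambda>U V n. sqrt (w n) * sub_dist ip (U n) (V n)"
  have L2: "(\<Sum>n<N. w n * (sub_dist ip (U n) (V n))\<^sup>2) = (L2_set (?f U V) {..<N})\<^sup>2" for U V N
    using w by (simp add: L2_set_def power_mult_distrib sum_nonneg)
  have iff: "seq_dist ip w U V \<le> ennreal c \<longleftrightarrow> (\<forall>N. L2_set (?f U V) {..<N} \<le> c)"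
    if "0 \<le> c" for U V c
    using that by (simp add: seq_dist_le_iff w L2 abs_le_square_iff[symmetric])
  have "L2_set (?f U W) {..<N} \<le> c + e" for N
  proof -
    have "L2_set (?f U W) {..<N} \<le> L2_set (\<lambda>n. ?f U V n + ?f V W n) {..<N}"
    proof (rule L2_set_mono)
      fix n
      have "sub_dist ip (U n) (W n) \<le> sub_dist ip (U n) (V n) + sub_dist ip (V n) (W n)"
        by (intro sub_dist_triangle complemented_seqsD U V W)
      then show "?f U W n \<le> ?f U V n + ?f V W n"
        using mult_left_mono[of _ _ "sqrt (w n)"] w by (fastforce simp flip: distrib_left)
      show "0 \<le> ?f U W n"
        by (intro mult_nonneg_nonneg sub_dist_nonneg complemented_seqsD U W) (simp add: w)
    qed
    also have "\<dots> \<le> L2_set (?f U V) {..<N} + L2_set (?f V W) {..<N}"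
      by (rule L2_set_triangle_ineq)
    also have "\<dots> \<le> c + e" using c e by (intro add_mono) (simp_all add: iff)
    finally show ?thesis .
  qed
  then show ?thesis using c e by (simp add: iff del: ennreal_plus)
qed

lemma seq_dist_self: "seq_dist ip w U U = 0"
  by (simp add: seq_dist_def sub_dist_self ennreal_sqrt_def)

lemma seq_ball_contains_ball:
  assumes w: "\<And>n. 0 \<le> w n" and U: "U \<in> complemented_seqs act ip"
    and W: "W \<in> seq_ball act ip w U r"
  obtains s where "0 < s" "seq_ball act ip w W s \<subseteq> seq_ball act ip w U r"
proof -
  have Wc: "W \<in> complemented_seqs act ip" and less: "seq_dist ip w U W < ennreal r"
    using W by (simp_all add: seq_ball_def)
  obtain D where D: "0 \<le> D" "D < r" "seq_dist ip w U W = ennreal D"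
    by (rule ennreal_less_obtain_real[OF less])
  have "V \<in> seq_ball act ip w U r" if "V \<in> seq_ball act ip w W (r - D)" for V
  proof -
    have Vc: "V \<in> complemented_seqs act ip" and "seq_dist ip w W V < ennreal (r - D)"
      using that by (simp_all add: seq_ball_def)
    then obtain E where E: "0 \<le> E" "E < r - D" "seq_dist ip w W V = ennreal E"
      by (elim ennreal_less_obtain_real)
    have "seq_dist ip w U V \<le> ennreal (D + E)"
      by (rule seq_dist_triangle[OF w U Wc Vc]) (simp_all add: D E)
    also have "\<dots> < ennreal r" using D E by (simp add: ennreal_less_iff del: ennreal_plus)
    finally show ?thesis using Vc by (simp add: seq_ball_def)
  qed
  then show thesis using that[of "r - D"] D by auto
qed

text \<open>\<open>topology\<close> returns the given family only if this family is a topology.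
  Unions of balls are therefore first identified with the sets containing a ball around each of
  their points, for which unions and finite intersections are easy.\<close>

lemma openin_seq_topology:
  assumes w: "\<And>n. 0 \<le> w n"
  shows "openin (seq_topology act ip w) S \<longleftrightarrow> S \<subseteq> complemented_seqs act ip \<and>
    (\<forall>U\<in>S. \<exists>r>0. seq_ball act ip w U r \<subseteq> S)"
proof -
  define opn where "opn S \<longleftrightarrow> S \<subseteq> complemented_seqs act ip \<and> (\<forall>U\<in>S. \<exists>r>0. seq_ball act ip w U r \<subseteq> S)" for S
  have opn: "(\<exists>\<B>. \<B> \<subseteq> {seq_ball act ip w U r | U r. U \<in> complemented_seqs act ip \<and> 0 \<le> r} \<and> S = \<Union>\<B>)
      \<longleftrightarrow> opn S" for S
  proof
    assume "\<exists>\<B>. \<B> \<subseteq> {seq_ball act ip w U r | U r. U \<in> complemented_seqs act ip \<and> 0 \<le> r} \<and> S = \<Union>\<B>"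
    then obtain \<B> where \<B>: "\<B> \<subseteq> {seq_ball act ip w U r | U r. U \<in> complemented_seqs act ip \<and> 0 \<le> r}"
      "S = \<Union>\<B>" by blast
    have "\<exists>r>0. seq_ball act ip w V r \<subseteq> S" if V: "V \<in> S" for V
    proof -
      obtain U r where U: "V \<in> seq_ball act ip w U r" "seq_ball act ip w U r \<in> \<B>"
        "U \<in> complemented_seqs act ip" using V \<B> by blast
      obtain s where "0 < s" "seq_ball act ip w V s \<subseteq> seq_ball act ip w U r"
        by (rule seq_ball_contains_ball[OF w U(3,1)])
      then show ?thesis using U(2) \<B>(2) by blast
    qed
    moreover have "S \<subseteq> complemented_seqs act ip" using \<B> by (auto simp: seq_ball_def)
    ultimately show "opn S" by (simp add: opn_def)
  next
    assume S: "opn S"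
    define \<B> where "\<B> = {seq_ball act ip w U r | U r. U \<in> complemented_seqs act ip \<and> 0 \<le> r
        \<and> seq_ball act ip w U r \<subseteq> S}"
    have "U \<in> \<Union>\<B>" if U: "U \<in> S" for U
    proof -
      obtain r where r: "r > 0" "seq_ball act ip w U r \<subseteq> S" using S U by (auto simp: opn_def)
      have Uc: "U \<in> complemented_seqs act ip" using S U by (auto simp: opn_def)
      then have "U \<in> seq_ball act ip w U r" using r by (simp add: seq_ball_def seq_dist_self)
      moreover have "seq_ball act ip w U r \<in> \<B>" using Uc r by (auto simp: \<B>_def intro: less_imp_le)
      ultimately show ?thesis by blast
    qed
    then have "S = \<Union>\<B>" by (auto simp: \<B>_def)
    moreover have "\<B> \<subseteq> {seq_ball act ip w U r | U r. U \<in> complemented_seqs act ip \<and> 0 \<le> r}"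
      by (auto simp: \<B>_def)
    ultimately show "\<exists>\<B>. \<B> \<subseteq> {seq_ball act ip w U r | U r. U \<in> complemented_seqs act ip \<and> 0 \<le> r} \<and> S = \<Union>\<B>"
      by blast
  qed
  have "istopology opn"
    unfolding istopology_def
  proof (intro conjI allI impI)
    fix S T assume S: "opn S" and T: "opn T"
    have "\<exists>r>0. seq_ball act ip w U r \<subseteq> S \<inter> T" if U: "U \<in> S \<inter> T" for U
    proof -
      obtain r s where rs: "r > 0" "s > 0" "seq_ball act ip w U r \<subseteq> S" "seq_ball act ip w U s \<subseteq> T"
        using S T U unfolding opn_def by blast
      have "seq_ball act ip w U (min r s) \<subseteq> seq_ball act ip w U r \<inter> seq_ball act ip w U s"
        by (auto simp: seq_ball_def elim!: less_le_trans intro: ennreal_leI)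
      then show ?thesis using rs by (intro exI[of _ "min r s"]) auto
    qed
    then show "opn (S \<inter> T)" using S by (auto simp: opn_def)
  next
    fix \<K> assume "\<forall>S\<in>\<K>. opn S"
    then show "opn (\<Union>\<K>)" unfolding opn_def by (meson Sup_least UnionE Union_upper order_trans)
  qed
  then have "openin (topology opn) S \<longleftrightarrow> opn S" by (simp add: topology_inverse')
  moreover have "seq_topology act ip w = topology opn" by (simp add: seq_topology_def opn)
  ultimately show ?thesis by (simp add: opn_def)
qed

section \<open>Perturbation of frames\<close>

lemma weight_norms_nonneg: "0 \<le> weight_norms \<omega> n"
  by (simp add: weight_norms_def)

text \<open>\<open>alg_inverse\<close> is a definite description, so uniqueness is needed besides
  the existence given by strict positivity.\<close>

lemma frame_lower_bound_invertible:
  assumes "frame_lower_bound act ip H \<omega> A"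
  shows "A * alg_inverse A = 1" "alg_inverse A * A = 1"
proof -
  have "alg_invertible A"
    using assms by (auto simp: frame_lower_bound_def frame_bounds_def strictly_positive_invertible)
  then obtain b where b: "A * b = 1" "b * A = 1" unfolding alg_invertible_def by blast
  have "c = b" if "A * c = 1" for c by (metis b(2) that mult.assoc mult.right_neutral mult_1)
  then have "\<exists>!b. A * b = 1 \<and> b * A = 1" using b by blast
  then have "A * alg_inverse A = 1 \<and> alg_inverse A * A = 1"
    unfolding alg_inverse_def by (rule theI')
  then show "A * alg_inverse A = 1" "alg_inverse A * A = 1" by auto
qed

lemma star_fusion_frame_perturb:
  assumes Hc: "H \<in> complemented_seqs act ip" and Kc: "K \<in> complemented_seqs act ip"
    and frame: "star_fusion_frame act ip H \<omega>" and lower: "frame_lower_bound act ip H \<omega> A"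
    and dist: "seq_dist ip (weight_norms \<omega>) H K < ennreal (inverse (norm (alg_inverse A)))"
  shows "star_fusion_frame act ip K \<omega>"
proof -
  define m where "m = inverse (norm (alg_inverse A))"
  have w: "weight \<omega>" using frame by (simp add: star_fusion_frame_def)
  obtain B where bounds: "frame_bounds act ip H \<omega> A B"
    using lower by (auto simp: frame_lower_bound_def)
  have Ai: "A * alg_inverse A = 1" "alg_inverse A * A = 1"
    using frame_lower_bound_invertible[OF lower] by auto
  then have "alg_inverse A \<noteq> 0" by auto
  then have m: "m > 0" by (simp add: m_def)
  obtain D where D: "0 \<le> D" "D < m" "seq_dist ip (weight_norms \<omega>) H K = ennreal D"
    using dist unfolding m_def[symmetric] by (rule ennreal_less_obtain_real)
  have part: "(\<Sum>n<N. weight_norms \<omega> n * (sub_dist ip (H n) (K n))\<^sup>2) \<le> D\<^sup>2" for N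
    using seq_dist_le_iff[where w = "weight_norms \<omega>" and c = D and ip = ip and U = H and V = K] D
    by (simp add: weight_norms_nonneg)
  have sd: "summable (\<lambda>n. weight_norms \<omega> n * (sub_dist ip (H n) (K n))\<^sup>2)"
    by (rule summableI_nonneg_bounded[OF _ part]) (simp add: weight_norms_nonneg)
  have sd_le: "(\<Sum>n. weight_norms \<omega> n * (sub_dist ip (H n) (K n))\<^sup>2) \<le> D\<^sup>2"
    by (rule suminf_le_const[OF sd part])
  define P where "P U x n = orth_proj ip (U n) x" for U :: "nat \<Rightarrow> 'h set" and x n
  define q where "q U x = (\<Sum>n. (\<omega> n)\<^sup>2 * ip (P U x n) (P U x n))" for U x
  define r where "r x = (\<Sum>n. (\<omega> n)\<^sup>2 * ip (P H x n - P K x n) (P H x n - P K x n))" for x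
  \<comment> \<open>The residual \<open>r\<close> is even in the difference, so it serves for both
    directions of the comparison.\<close>
  have swap: "ip (P H x n - P K x n) (P H x n - P K x n) = ip (P K x n - P H x n) (P K x n - P H x n)"
    for x n by (simp add: ip_diff_left ip_diff_right)
  have sH: "summable (\<lambda>n. (\<omega> n)\<^sup>2 * ip (P H x n) (P H x n))" for x
    using frame by (simp add: star_fusion_frame_def P_def)
  have sr: "summable (\<lambda>n. (\<omega> n)\<^sup>2 * ip (P H x n - P K x n) (P H x n - P K x n))"
    and r: "norm (r x) \<le> D\<^sup>2 * (norm x)\<^sup>2" for x
    unfolding r_def P_def using proj_diff_terms[OF Hc Kc sd sd_le] by auto
  \<comment> \<open>With d = 1 each term for K is at most twice the term for H plus twice the
    residual term. Convergence has to precede any use of the sum \<open>q K x\<close>.\<close>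
  have sK: "summable (\<lambda>n. (\<omega> n)\<^sup>2 * ip (P K x n) (P K x n))" for x
    using proj_terms_le[OF w, of 1]
    by (intro summable_positive_dominated[OF summable_add[OF
          summable_scaleR_right[OF sH[of x], of 2] summable_scaleR_right[OF sr[of x], of 2]]]
        positive_weight_mult w ip_positive) simp
  \<comment> \<open>Here d stays free, because the lower estimate must exploit D < m exactly; the
    upper estimate needs no sharp constant and takes d = 1.\<close>
  have H_K: "norm (q H x) \<le> (1 + d) * norm (q K x) + (1 + 1 / d) * norm (r x)" if "d > 0" for d x
    using proj_sum_norm_le[OF w that sK sH, of x x] sr[of x] by (simp add: q_def r_def swap)
  have K_H: "norm (q K x) \<le> 2 * norm (q H x) + 2 * norm (r x)" for x
    using proj_sum_norm_le[OF w zero_less_one sH sK, of x x] sr[of x] by (simp add: q_def r_def)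
  have qH_lower: "m\<^sup>2 * (norm x)\<^sup>2 \<le> norm (q H x)" for x
  proof -
    have "positive_elem (q H x - ip (act A x) (act A x))"
      using bounds by (simp add: frame_bounds_def cstar_le_def q_def P_def)
    then have "(norm (act A x))\<^sup>2 \<le> norm (q H x)"
      using norm_mono_positive[OF ip_positive] norm_ip by metis
    moreover have "norm x \<le> norm (alg_inverse A) * norm (act A x)"
      using norm_act_le[of "alg_inverse A" "act A x"] by (simp add: act_act Ai act_one)
    then have "m * norm x \<le> norm (act A x)"
      using \<open>alg_inverse A \<noteq> 0\<close> by (simp add: m_def field_simps)
    then have "(m * norm x)\<^sup>2 \<le> (norm (act A x))\<^sup>2" using m by (intro power_mono) auto
    ultimately show ?thesis by (simp add: power_mult_distrib)
  qed
  have qH_upper: "norm (q H x) \<le> (norm B)\<^sup>2 * (norm x)\<^sup>2" for x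
  proof -
    have "positive_elem (ip (act B x) (act B x) - q H x)"
      using bounds by (simp add: frame_bounds_def cstar_le_def q_def P_def)
    moreover have "positive_elem (q H x)"
      unfolding q_def by (intro positive_suminf sH positive_weight_mult w ip_positive)
    ultimately have "norm (q H x) \<le> (norm (act B x))\<^sup>2"
      using norm_mono_positive norm_ip by metis
    also have "\<dots> \<le> (norm B * norm x)\<^sup>2" by (intro power_mono norm_act_le) simp
    finally show ?thesis by (simp add: power_mult_distrib)
  qed
  have pK: "positive_elem (q K x)" for x
    unfolding q_def by (intro positive_suminf sK positive_weight_mult w ip_positive)
  have homK: "q K (act a x) = a * q K x * star a" for a x
    using proj_sum_act[OF w Kc] sK by (simp add: q_def P_def)
  have homI: "ip (act a x) (act a x) = a * ip x x * star a" for a x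
    by (simp add: ip_act_left ip_act_right mult.assoc)
  have "D\<^sup>2 < m\<^sup>2" using D by (simp add: power_strict_mono)
  \<comment> \<open>Chosen so that e D^2 uses up at most half of the gap m^2 - D^2; the summand 1
    avoids division by zero when D = 0.\<close>
  define e where "e = (m\<^sup>2 - D\<^sup>2) / 2 / (D\<^sup>2 + 1)"
  have D1: "D\<^sup>2 + 1 > 0" by (simp add: add_nonneg_pos)
  have e: "e > 0" unfolding e_def using \<open>D\<^sup>2 < m\<^sup>2\<close> D1 by simp
  have "e * D\<^sup>2 \<le> e * (D\<^sup>2 + 1)" using e by simp
  also have "\<dots> = (m\<^sup>2 - D\<^sup>2) / 2" 
    by (rule iffD1[OF nonzero_eq_divide_eq e_def]) (use D1 in linarith)
  finally have "(1 + e) * D\<^sup>2 < m\<^sup>2" using \<open>D\<^sup>2 < m\<^sup>2\<close> by (simp add: algebra_simps)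
  then have g: "m\<^sup>2 - (1 + e) * D\<^sup>2 > 0" by simp
  \<comment> \<open>Comes from solving the estimate below for (norm x)^2.\<close>
  define C where "C = (1 + 1 / e) / (m\<^sup>2 - (1 + e) * D\<^sup>2)"
  have C: "C > 0" using e g by (simp add: C_def add_pos_pos)
  have "norm (ip x x) \<le> C * norm (q K x)" for x
  proof -
    \<comment> \<open>Taking d = 1 / e puts the factor close to 1 on the residual and the large one
      on \<open>q K x\<close>.\<close>
    have "m\<^sup>2 * (norm x)\<^sup>2 \<le> (1 + 1 / e) * norm (q K x) + (1 + e) * norm (r x)"
      using H_K[of "1 / e" x] qH_lower[of x] e by simp
    also have "\<dots> \<le> (1 + 1 / e) * norm (q K x) + (1 + e) * (D\<^sup>2 * (norm x)\<^sup>2)"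
      using r[of x] e by (intro add_left_mono mult_left_mono) auto
    finally have "(m\<^sup>2 - (1 + e) * D\<^sup>2) * (norm x)\<^sup>2 \<le> (1 + 1 / e) * norm (q K x)"
      by (simp add: algebra_simps)
    then show ?thesis using g by (simp add: C_def norm_ip pos_le_divide_eq mult.commute)
  qed
  then have lowK: "positive_elem (C *\<^sub>R q K x - ip x x)" for x
    using C by (intro le_of_norm_le ip_positive pK homI homK) auto
  \<comment> \<open>The summand 1 makes positivity of E immediate.\<close>
  define E where "E = 2 * (norm B)\<^sup>2 + 2 * D\<^sup>2 + 1"
  have E: "E > 0" by (simp add: E_def add_nonneg_pos)
  have "norm (q K x) \<le> E * norm (ip x x)" for x
    using K_H[of x] qH_upper[of x] r[of x] zero_le_power2[of "norm x"]
    unfolding E_def norm_ip distrib_right mult.assoc mult_1 by linarith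
  then have upK: "positive_elem (E *\<^sub>R ip x x - q K x)" for x
    using E by (intro le_of_norm_le ip_positive pK homI homK) auto
  have scal: "ip (act (of_real s) x) (act (of_real s) x) = s\<^sup>2 *\<^sub>R ip x x" for s x
    by (simp add: act_of_real ip_scaleR_left ip_scaleR_right power2_eq_square)
  \<comment> \<open>The frame inequality squares its bounds, hence the square roots.\<close>
  have "frame_bounds act ip K \<omega> (of_real (1 / sqrt C)) (of_real (sqrt E))"
    unfolding frame_bounds_def cstar_le_def mod_abs_power2 scal
  proof (intro conjI allI)
    show "strictly_positive (of_real (1 / sqrt C) :: 'a)" "strictly_positive (of_real (sqrt E) :: 'a)"
      by (rule strictly_positive_of_real, use C E in simp)+
    fix x
    have "positive_elem ((1 / C) *\<^sub>R (C *\<^sub>R q K x - ip x x))"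
      using C by (intro positive_scaleR lowK) simp
    then show "positive_elem ((\<Sum>n. (\<omega> n)\<^sup>2 * ip (orth_proj ip (K n) x) (orth_proj ip (K n) x))
        - (1 / sqrt C)\<^sup>2 *\<^sub>R ip x x)"
      using C by (simp add: scaleR_right_diff_distrib power_divide q_def P_def)
    show "positive_elem ((sqrt E)\<^sup>2 *\<^sub>R ip x x
        - (\<Sum>n. (\<omega> n)\<^sup>2 * ip (orth_proj ip (K n) x) (orth_proj ip (K n) x)))"
      using E upK[of x] by (simp add: q_def P_def)
  qed
  then show ?thesis using Kc w sK unfolding star_fusion_frame_def P_def by auto
qed

end

theorem theorem5p1:
  fixes act :: "'a::unital_cstar_algebra \<Rightarrow> 'h::banach \<Rightarrow> 'h"
    and ip :: "'h \<Rightarrow> 'h \<Rightarrow> 'a"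
    and \<omega> :: "nat \<Rightarrow> 'a"
  assumes "hilbert_module act ip"
    and "weight \<omega>"
  shows "(\<forall>H\<in>complemented_seqs act ip. \<forall>K\<in>complemented_seqs act ip. \<forall>A.
            star_fusion_frame act ip H \<omega> \<and> frame_lower_bound act ip H \<omega> A \<and>
            seq_dist ip (weight_norms \<omega>) H K < ennreal (inverse (norm (alg_inverse A)))
            \<longrightarrow> star_fusion_frame act ip K \<omega>)
       \<and> openin (seq_topology act ip (weight_norms \<omega>)) (frame_seqs act ip \<omega>)"
proof -
  interpret hilbert_module act ip by (rule assms(1))
  have "\<exists>r>0. seq_ball act ip (weight_norms \<omega>) H r \<subseteq> frame_seqs act ip \<omega>"
    if H: "H \<in> frame_seqs act ip \<omega>" for H
  proof -
    have Hc: "H \<in> complemented_seqs act ip" "star_fusion_frame act ip H \<omega>"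
      using H by (simp_all add: frame_seqs_def)
    then obtain A where A: "frame_lower_bound act ip H \<omega> A"
      by (auto simp: star_fusion_frame_def frame_lower_bound_def)
    have "alg_inverse A \<noteq> 0" using frame_lower_bound_invertible[OF A] by auto
    moreover have "seq_ball act ip (weight_norms \<omega>) H (inverse (norm (alg_inverse A)))
        \<subseteq> frame_seqs act ip \<omega>"
      using star_fusion_frame_perturb[OF Hc(1) _ Hc(2) A]
      by (auto simp: seq_ball_def frame_seqs_def)
    ultimately show ?thesis by (intro exI[of _ "inverse (norm (alg_inverse A))"]) auto
  qed
  then have "openin (seq_topology act ip (weight_norms \<omega>)) (frame_seqs act ip \<omega>)"
    by (auto simp: openin_seq_topology weight_norms_nonneg frame_seqs_def)
  then show ?thesis using star_fusion_frame_perturb by blast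
qed

end
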